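(* There is an algorithm which, from a finite alphabet $A$ and a finite partial deterministic inverse $\widetilde A$-transducer $\mathcal T=(Q,q_0,\delta,\lambda)$, constructs a finite set $Y$ and homomorphisms $g,h:F_Y\to F_A$ of free groups such that $h$ is injective and $$\operatorname{Eq}(g,h)\neq\{1\}\quad\Longleftrightarrow\quad \mathcal T\text{ has a nontrivial fixed loop at }q_0.$$
   Context: For a finite alphabet $A$, let $\widetilde A=A\cup A^{-1}$ ($A^{-1}$ the set of formal inverses), let $F_A$ be the free group on $A$, and for $g\in F_A$ let $\overline g$ be its freely reduced representative word over $\widetilde A$. Maps are written on the right. $\operatorname{Eq}(g,h)=\{x\in F_Y\mid xg=xh\}$. A finite partial deterministic $\widetilde A$-transducer is $\mathcal T=(Q,q_0,\delta,\lambda)$ with $Q$ a finite set of states, $q_0\in Q$ the initial state, and partial functions $\delta:Q\times\widetilde A\rightharpoonup Q$, $\lambda:Q\times\widetilde A\rightharpoonup\widetilde A^*$ with the same domain. If $(q,a)\delta=r$ and $(q,a)\lambda=U$, we say $q\xrightarrow{a\mid U}r$ is an edge. Both are extended to words in the usual way: reading a word follows edges consecutively and concatenates outputs; a word $u$ is readable from $q$ if $(q,u)\delta$ is defined. The transducer is inverse if $p\xrightarrow{a\mid w}q$ is an edge if and only if $q\xrightarrow{a^{-1}\mid w^{-1}}p$ is an edge ($w^{-1}$ being the formal inverse word). An inverse transducer defines a partial map $\widetilde{\mathcal T}:F_A\rightharpoonup F_A$: $g\widetilde{\mathcal T}$ is defined if and only if $\overline g$ is readable from $q_0$, and then it is the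 element of $F_A$ represented by $(q_0,\overline g)\lambda$. A fixed loop at $q_0$ is an element $w\in F_A$ such that $w\widetilde{\mathcal T}$ is defined, $w\widetilde{\mathcal T}=w$ and $(q_0,\overline w)\delta=q_0$; it is nontrivial if $w\neq1$. *)

theory Defs
  imports "HOL-Algebra.Group" "HOL-Library.Nat_Bijection"
begin

section \<open>Words and free groups\<close>

text \<open>
  The letter \<open>(a, True)\<close> stands for \<open>a\<close> and \<open>(a, False)\<close> for its formal inverse.
  The free group on \<open>A\<close> is realised on the freely reduced words, so that an element
  of it is its own reduced representative.
\<close>

type_synonym 'a letter = "'a \<times> bool"
type_synonym 'a word = "'a letter list"

definition letters :: "'a set \<Rightarrow> 'a letter set" where
  "letters A = A \<times> UNIV"

definition inv_letter :: "'a letter \<Rightarrow> 'a letter" where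
  "inv_letter x = (fst x, \<not> snd x)"

definition inv_word :: "'a word \<Rightarrow> 'a word" where
  "inv_word w = rev (map inv_letter w)"

definition reduced :: "'a word \<Rightarrow> bool" where
  "reduced w \<longleftrightarrow> successively (\<lambda>x y. y \<noteq> inv_letter x) w"

fun cancel_Cons :: "'a letter \<Rightarrow> 'a word \<Rightarrow> 'a word" where
  "cancel_Cons x [] = [x]"
| "cancel_Cons x (y # w) = (if y = inv_letter x then w else x # y # w)"

definition free_reduce :: "'a word \<Rightarrow> 'a word" where
  "free_reduce w = foldr cancel_Cons w []"

definition free_group :: "'a set \<Rightarrow> 'a word monoid" where
  "free_group A =
     \<lparr>carrier = {w \<in> lists (letters A). reduced w},
      mult = (\<lambda>u v. free_reduce (u @ v)),
      one = []\<rparr>"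

lemma inv_letter_invol [simp]: "inv_letter (inv_letter x) = x"
  by (simp add: inv_letter_def)

lemma reduced_Nil [simp]: "reduced []"
  by (simp add: reduced_def)

lemma reduced_ConsD: "reduced (x # w) \<Longrightarrow> reduced w"
  by (cases w) (auto simp: reduced_def)

lemma reduced_cancel_Cons: "reduced w \<Longrightarrow> reduced (cancel_Cons x w)"
  by (cases w) (auto simp: reduced_def dest: reduced_ConsD[unfolded reduced_def])

lemma reduced_free_reduce: "reduced (free_reduce w)"
  by (induction w) (simp_all add: free_reduce_def reduced_cancel_Cons)

lemma free_reduce_id: "reduced w \<Longrightarrow> free_reduce w = w"
proof (induction w)
  case (Cons x w)
  then have "free_reduce w = w" using reduced_ConsD by blast
  with Cons.prems show ?case
    by (cases w) (auto simp: free_reduce_def reduced_def)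
qed (simp add: free_reduce_def)

lemma cancel_Cons_inverse:
  assumes "reduced w"
  shows "cancel_Cons (inv_letter x) (cancel_Cons x w) = w"
proof (cases w)
  case (Cons y v)
  with assms show ?thesis by (cases v) (auto simp: reduced_def)
qed simp

lemma reduced_foldr_cancel: "reduced w \<Longrightarrow> reduced (foldr cancel_Cons u w)"
  by (induction u) (simp_all add: reduced_cancel_Cons)

lemma foldr_cancel_Cons:
  assumes "reduced w"
  shows "foldr cancel_Cons (cancel_Cons x v) w = cancel_Cons x (foldr cancel_Cons v w)"
proof (cases v)
  case (Cons y u)
  then show ?thesis
    using cancel_Cons_inverse[of "foldr cancel_Cons u w" "inv_letter x"] assms
    by (auto simp: reduced_foldr_cancel)
qed simp

lemma foldr_free_reduce:
  "reduced w \<Longrightarrow> foldr cancel_Cons (free_reduce u) w = foldr cancel_Cons u w"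
  by (induction u) (simp_all add: free_reduce_def foldr_cancel_Cons)

lemma free_reduce_append_left: "free_reduce (free_reduce u @ v) = free_reduce (u @ v)"
  using foldr_free_reduce[OF reduced_free_reduce[of v], of u] by (simp add: free_reduce_def)

lemma free_reduce_append_right: "free_reduce (u @ free_reduce v) = free_reduce (u @ v)"
  using free_reduce_id[OF reduced_free_reduce[of v]] by (simp add: free_reduce_def)

lemma set_free_reduce: "set (free_reduce w) \<subseteq> set w"
proof (induction w)
  case (Cons x w)
  have "set (cancel_Cons x v) \<subseteq> insert x (set v)" for v by (cases v) auto
  with Cons show ?case by (fastforce simp: free_reduce_def)
qed (simp add: free_reduce_def)

lemma free_reduce_inv_word: "free_reduce (inv_word w @ w) = []"
proof (induction w)
  case (Cons x w)
  have "free_reduce (inv_word (x # w) @ x # w)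
      = foldr cancel_Cons (inv_word w) (free_reduce w)"
    using cancel_Cons_inverse[OF reduced_free_reduce[of w], of x]
    by (simp add: inv_word_def free_reduce_def)
  also have "\<dots> = []" using Cons by (simp add: free_reduce_def)
  finally show ?case .
qed (simp add: inv_word_def free_reduce_def)

lemma group_free_group: "group (free_group A)"
proof (rule groupI)
  fix x y assume "x \<in> carrier (free_group A)" "y \<in> carrier (free_group A)"
  then show "x \<otimes>\<^bsub>free_group A\<^esub> y \<in> carrier (free_group A)"
    using set_free_reduce[of "x @ y"]
    by (auto simp: free_group_def reduced_free_reduce lists_eq_set)
next
  fix x assume x: "x \<in> carrier (free_group A)"
  let ?y = "free_reduce (inv_word x)"
  have "set ?y \<subseteq> letters A"
    using x set_free_reduce[of "inv_word x"]
    by (fastforce simp: free_group_def inv_word_def letters_def inv_letter_def)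
  then have "?y \<in> carrier (free_group A)"
    by (auto simp: free_group_def reduced_free_reduce)
  moreover have "?y \<otimes>\<^bsub>free_group A\<^esub> x = \<one>\<^bsub>free_group A\<^esub>"
    by (simp add: free_group_def free_reduce_append_left free_reduce_inv_word)
  ultimately show "\<exists>y\<in>carrier (free_group A). y \<otimes>\<^bsub>free_group A\<^esub> x = \<one>\<^bsub>free_group A\<^esub>"
    by blast
qed (auto simp: free_group_def free_reduce_append_left free_reduce_append_right free_reduce_id)

definition equalizer :: "('a, 'm) monoid_scheme \<Rightarrow> ('a \<Rightarrow> 'b) \<Rightarrow> ('a \<Rightarrow> 'b) \<Rightarrow> 'a set" where
  "equalizer G g h = {x \<in> carrier G. g x = h x}"

section \<open>Transducers\<close>

record ('q, 'a) transducer =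
  states :: "'q set"
  init :: 'q
  delta :: "'q \<Rightarrow> 'a letter \<Rightarrow> 'q option"
  lambda :: "'q \<Rightarrow> 'a letter \<Rightarrow> 'a word option"

definition transducer_over :: "'a set \<Rightarrow> ('q, 'a) transducer \<Rightarrow> bool" where
  "transducer_over A T \<longleftrightarrow>
     finite (states T) \<and> init T \<in> states T \<and>
     (\<forall>q x. delta T q x = None \<longleftrightarrow> lambda T q x = None) \<and>
     (\<forall>q x r. delta T q x = Some r \<longrightarrow> q \<in> states T \<and> x \<in> letters A \<and> r \<in> states T) \<and>
     (\<forall>q x u. lambda T q x = Some u \<longrightarrow> u \<in> lists (letters A))"

definition edges :: "('q, 'a) transducer \<Rightarrow> ('q \<times> 'a letter \<times> 'a word \<times> 'q) set" where
  "edges T = {(p, x, u, q). delta T p x = Some q \<and> lambda T p x = Some u}"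

definition inverse_transducer :: "('q, 'a) transducer \<Rightarrow> bool" where
  "inverse_transducer T \<longleftrightarrow>
     (\<forall>p x u q. (p, x, u, q) \<in> edges T \<longleftrightarrow> (q, inv_letter x, inv_word u, p) \<in> edges T)"

primrec delta_word :: "('q, 'a) transducer \<Rightarrow> 'q \<Rightarrow> 'a word \<Rightarrow> 'q option" where
  "delta_word T q [] = Some q"
| "delta_word T q (x # w) = Option.bind (delta T q x) (\<lambda>r. delta_word T r w)"

primrec lambda_word :: "('q, 'a) transducer \<Rightarrow> 'q \<Rightarrow> 'a word \<Rightarrow> 'a word option" where
  "lambda_word T q [] = Some []"
| "lambda_word T q (x # w) =
     Option.bind (delta T q x) (\<lambda>r.
     Option.bind (lambda T q x) (\<lambda>u.
     Option.bind (lambda_word T r w) (\<lambda>v. Some (u @ v))))"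

definition transducer_map :: "('q, 'a) transducer \<Rightarrow> 'a word \<Rightarrow> 'a word option" where
  "transducer_map T g = map_option free_reduce (lambda_word T (init T) g)"

definition fixed_loop :: "'a set \<Rightarrow> ('q, 'a) transducer \<Rightarrow> 'a word \<Rightarrow> bool" where
  "fixed_loop A T w \<longleftrightarrow>
     w \<in> carrier (free_group A) \<and> transducer_map T w = Some w \<and>
     delta_word T (init T) w = Some (init T)"

section \<open>Algorithms: partial recursive functions\<close>

datatype recf =
    Zero
  | Succ
  | Proj nat
  | Comp recf "recf list"
  | PrimRec recf recf
  | Mu recf

text \<open>\<open>evaluates f xs y\<close>: the partial function denoted by \<open>f\<close> is defined at \<open>xs\<close>, with value \<open>y\<close>.\<close>

inductive evaluates :: "recf \<Rightarrow> nat list \<Rightarrow> nat \<Rightarrow> bool" where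
  Zero: "evaluates Zero xs 0"
| Succ: "evaluates Succ [x] (Suc x)"
| Proj: "i < length xs \<Longrightarrow> evaluates (Proj i) xs (xs ! i)"
| Comp: "\<lbrakk>length ys = length fs; \<forall>i<length fs. evaluates (fs ! i) xs (ys ! i); evaluates f ys z\<rbrakk>
    \<Longrightarrow> evaluates (Comp f fs) xs z"
| PrimRec_0: "evaluates f xs z \<Longrightarrow> evaluates (PrimRec f g) (0 # xs) z"
| PrimRec_Suc: "\<lbrakk>evaluates (PrimRec f g) (n # xs) r; evaluates g (n # r # xs) z\<rbrakk>
    \<Longrightarrow> evaluates (PrimRec f g) (Suc n # xs) z"
| Mu: "\<lbrakk>evaluates f (n # xs) 0; \<forall>m<n. \<exists>k. evaluates f (m # xs) (Suc k)\<rbrakk>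
    \<Longrightarrow> evaluates (Mu f) xs n"

inductive_cases evaluates_ZeroE: "evaluates Zero xs y"
inductive_cases evaluates_SuccE: "evaluates Succ xs y"
inductive_cases evaluates_ProjE: "evaluates (Proj i) xs y"
inductive_cases evaluates_CompE: "evaluates (Comp f fs) xs y"
inductive_cases evaluates_PrimRec_0E: "evaluates (PrimRec f g) (0 # xs) y"
inductive_cases evaluates_PrimRec_SucE: "evaluates (PrimRec f g) (Suc n # xs) y"
inductive_cases evaluates_MuE: "evaluates (Mu f) xs y"

lemma evaluates_deterministic: "evaluates f xs y \<Longrightarrow> evaluates f xs z \<Longrightarrow> y = z"
proof (induction arbitrary: z rule: evaluates.induct)
  case (Comp ys fs xs f y)
  from Comp.prems obtain zs where zs: "length zs = length fs"
      "\<forall>i<length fs. evaluates (fs ! i) xs (zs ! i)" "evaluates f zs z"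
    by (rule evaluates_CompE) blast
  then have "ys = zs" using Comp.hyps Comp.IH(1) by (intro nth_equalityI) auto
  with zs Comp.IH(2) show ?case by blast
next
  case (PrimRec_Suc f g n xs r y)
  from PrimRec_Suc.prems obtain r' where "evaluates (PrimRec f g) (n # xs) r'" "evaluates g (n # r' # xs) z"
    by (rule evaluates_PrimRec_SucE)
  with PrimRec_Suc.IH show ?case by blast
next
  case (Mu f n xs)
  from Mu.prems obtain "evaluates f (z # xs) 0" "\<forall>m<z. \<exists>k. evaluates f (m # xs) (Suc k)"
    by (rule evaluates_MuE) blast
  with Mu.IH show ?case by (metis nat.distinct(1) nat_neq_iff)
qed (blast elim: evaluates_ZeroE evaluates_SuccE evaluates_ProjE evaluates_PrimRec_0E)+

section \<open>Encodings\<close>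

text \<open>
  Symbols of alphabets and states are natural numbers, so that inputs and outputs of
  algorithms are finite objects; a finite set is presented by any list of its elements.
\<close>

definition letter_code :: "nat letter \<Rightarrow> nat" where
  "letter_code x = prod_encode (fst x, of_bool (snd x))"

definition word_code :: "nat word \<Rightarrow> nat" where
  "word_code w = list_encode (map letter_code w)"

definition edge_code :: "nat \<times> nat letter \<times> nat word \<times> nat \<Rightarrow> nat" where
  "edge_code = (\<lambda>(p, x, u, q). list_encode [p, letter_code x, word_code u, q])"

definition encodes_transducer :: "nat \<Rightarrow> nat set \<Rightarrow> (nat, nat) transducer \<Rightarrow> bool" where
  "encodes_transducer c A T \<longleftrightarrow>
     (\<exists>as qs es. set as = A \<and> set qs = states T \<and> set es = edges T \<and>
        c = list_encode [list_encode as, list_encode qs, init T, list_encode (map edge_code es)])"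

text \<open>Homomorphisms \<open>g, h\<close> from the free group on \<open>Y\<close> are presented by the images of the generators.\<close>

definition encodes_hom_pair ::
    "nat \<Rightarrow> nat set \<Rightarrow> (nat word \<Rightarrow> nat word) \<Rightarrow> (nat word \<Rightarrow> nat word) \<Rightarrow> bool" where
  "encodes_hom_pair d Y g h \<longleftrightarrow>
     (\<exists>ys. set ys = Y \<and>
        d = list_encode (map (\<lambda>y.
          list_encode [y, word_code (g [(y, True)]), word_code (h [(y, True)])]) ys))"

end

theory Submission
  imports Defs
begin

text \<open>
  The loops of the transducer at the initial state represent the fundamental group of its underlying
  graph, which is free on the positive edges outside a spanning tree. Let \<open>W p\<close> be the tree path to
  the state \<open>p\<close>; the generator of an edge from \<open>p\<close> to \<open>q\<close> labelled \<open>x\<close> is sent by \<open>h\<close> to the loop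
  \<open>W p \<cdot> x \<cdot> (W q)\<inverse>\<close> and by \<open>g\<close> to the output along it, so that \<open>g = h\<close> on an element says exactly that
  the corresponding loop is fixed. Replacing the outputs by the names of the generators crossed gives
  an inverse transducer that inverts \<open>h\<close>. A spanning tree is found by repeated sweeps over the list
  of edges, and the functions computable on encoded data are closed under everything this needs.
\<close>

section \<open>Computable functions on encoded data\<close>

lemma evaluates_Proj0: "evaluates (Proj 0) (x # xs) x"
  using evaluates.Proj[of 0 "x # xs"] by simp

lemma evaluates_Proj1: "evaluates (Proj 1) (x # y # xs) y"
  using evaluates.Proj[of 1 "x # y # xs"] by simp

lemma evaluates_Proj2: "evaluates (Proj 2) (x # y # z # xs) z"
  using evaluates.Proj[of 2 "x # y # z # xs"] by simp

lemma evaluates_Comp1: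
  "evaluates g xs y \<Longrightarrow> evaluates f [y] z \<Longrightarrow> evaluates (Comp f [g]) xs z"
  by (rule evaluates.Comp[where ys = "[y]"]) simp_all

lemma evaluates_Comp2:
  "evaluates g1 xs y1 \<Longrightarrow> evaluates g2 xs y2 \<Longrightarrow> evaluates f [y1, y2] z \<Longrightarrow>
    evaluates (Comp f [g1, g2]) xs z"
  by (rule evaluates.Comp[where ys = "[y1, y2]"]) (auto simp: less_Suc_eq)

lemma evaluates_Comp3:
  "evaluates g1 xs y1 \<Longrightarrow> evaluates g2 xs y2 \<Longrightarrow> evaluates g3 xs y3 \<Longrightarrow>
    evaluates f [y1, y2, y3] z \<Longrightarrow> evaluates (Comp f [g1, g2, g3]) xs z"
  by (rule evaluates.Comp[where ys = "[y1, y2, y3]"]) (auto simp: less_Suc_eq)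

named_theorems evaluates_intros

declare evaluates.Zero [evaluates_intros] evaluates.Succ [evaluates_intros]
  evaluates_Proj0 [evaluates_intros] evaluates_Proj1 [evaluates_intros]
  evaluates_Proj2 [evaluates_intros] evaluates_Comp1 [evaluates_intros]
  evaluates_Comp2 [evaluates_intros] evaluates_Comp3 [evaluates_intros]

definition "rf_add = PrimRec (Proj 0) (Comp Succ [Proj 1])"
definition "rf_pred = PrimRec Zero (Proj 0)"
text \<open>Primitive recursion runs over the first argument, so it is the first argument that gets
  subtracted from the second.\<close>

definition "rf_diff = PrimRec (Proj 0) (Comp rf_pred [Proj 1])"
definition "rf_triangle = PrimRec Zero (Comp Succ [Comp rf_add [Proj 0, Proj 1]])"
definition "rf_pair = Comp rf_add [Comp rf_triangle [Comp rf_add [Proj 0, Proj 1]], Proj 0]"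
text \<open>For \<open>z = prod_encode (m, n) = triangle (m + n) + m\<close> the diagonal
  \<open>m + n\<close> is the least \<open>k\<close> with \<open>z < triangle (Suc k)\<close>, that
  is, with truncated difference \<open>Suc z - triangle (Suc k)\<close> equal to 0. This is the only
  unbounded search; the two projections are then differences.\<close>

definition "rf_diagonal =
  Mu (Comp rf_diff [Comp rf_triangle [Comp Succ [Proj 0]], Comp Succ [Proj 1]])"
definition "rf_fst = Comp rf_diff [Comp rf_triangle [rf_diagonal], Proj 0]"
definition "rf_snd = Comp rf_diff [rf_fst, rf_diagonal]"
text \<open>A recursion whose step ignores the previous value: on \<open>[b, m, n]\<close> the base
  case selects \<open>n\<close> and every later step selects \<open>m\<close>.\<close>

definition "rf_if = PrimRec (Proj 1) (Proj 2)"

lemma evaluates_add [evaluates_intros]: "evaluates rf_add [m, n] (m + n)"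
proof (induction m)
  case 0
  have "evaluates rf_add [0, n] n"
    unfolding rf_add_def by (rule PrimRec_0, rule evaluates_intros)
  then show ?case by simp
next
  case (Suc m)
  have "evaluates rf_add [Suc m, n] (Suc (m + n))"
    unfolding rf_add_def
    by (rule PrimRec_Suc, rule Suc[unfolded rf_add_def], (rule evaluates_intros)+)
  then show ?case by simp
qed

lemma evaluates_pred [evaluates_intros]: "evaluates rf_pred [n] (n - 1)"
proof (induction n)
  case 0
  have "evaluates rf_pred [0] 0"
    unfolding rf_pred_def by (rule PrimRec_0, rule evaluates_intros)
  then show ?case by simp
next
  case (Suc n)
  have "evaluates rf_pred [Suc n] n"
    unfolding rf_pred_def
    by (rule PrimRec_Suc, rule Suc[unfolded rf_pred_def], (rule evaluates_intros)+)
  then show ?case by simp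
qed

lemma evaluates_diff [evaluates_intros]: "evaluates rf_diff [m, n] (n - m)"
proof (induction m)
  case 0
  have "evaluates rf_diff [0, n] n"
    unfolding rf_diff_def by (rule PrimRec_0, rule evaluates_intros)
  then show ?case by simp
next
  case (Suc m)
  have "evaluates rf_diff [Suc m, n] (n - m - 1)"
    unfolding rf_diff_def
    by (rule PrimRec_Suc, rule Suc[unfolded rf_diff_def], (rule evaluates_intros)+)
  then show ?case by simp
qed

lemma evaluates_triangle [evaluates_intros]: "evaluates rf_triangle [n] (triangle n)"
proof (induction n)
  case 0
  have "evaluates rf_triangle [0] 0"
    unfolding rf_triangle_def by (rule PrimRec_0, rule evaluates_intros)
  then show ?case by simp
next
  case (Suc n)
  have "evaluates rf_triangle [Suc n] (Suc (n + triangle n))"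
    unfolding rf_triangle_def
    by (rule PrimRec_Suc, rule Suc[unfolded rf_triangle_def], (rule evaluates_intros)+)
  then show ?case by (simp add: add.commute)
qed

lemma evaluates_pair [evaluates_intros]: "evaluates rf_pair [m, n] (prod_encode (m, n))"
  unfolding rf_pair_def prod_encode_def prod.case by (rule evaluates_intros)+

lemma triangle_mono: "m \<le> n \<Longrightarrow> triangle m \<le> triangle n"
  by (induction rule: dec_induct) auto

lemma evaluates_diagonal [evaluates_intros]: "evaluates rf_diagonal [prod_encode (m, n)] (m + n)"
proof -
  let ?z = "prod_encode (m, n)"
  let ?f = "Comp rf_diff [Comp rf_triangle [Comp Succ [Proj 0]], Comp Succ [Proj 1]]"
  have f: "evaluates ?f [k, ?z] (Suc ?z - triangle (Suc k))" for k
    by (rule evaluates_intros)+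
  have "evaluates ?f [m + n, ?z] 0"
    using f[of "m + n"] by (simp add: prod_encode_def)
  moreover have "\<exists>l. evaluates ?f [k, ?z] (Suc l)" if "k < m + n" for k
  proof -
    have "triangle (Suc k) \<le> ?z"
      using that triangle_mono[of "Suc k" "m + n"] by (simp add: prod_encode_def)
    then show ?thesis using f[of k] by (metis Suc_diff_le)
  qed
  ultimately show ?thesis unfolding rf_diagonal_def by (auto intro: evaluates.Mu)
qed

lemma evaluates_fst [evaluates_intros]: "evaluates rf_fst [prod_encode (m, n)] m"
proof -
  let ?z = "prod_encode (m, n)"
  have "evaluates rf_fst [?z] (?z - triangle (m + n))"
    unfolding rf_fst_def by (rule evaluates_intros)+
  then show ?thesis by (simp add: prod_encode_def)
qed

lemma evaluates_snd [evaluates_intros]: "evaluates rf_snd [prod_encode (m, n)] n"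
proof -
  have "evaluates rf_snd [prod_encode (m, n)] (m + n - m)"
    unfolding rf_snd_def by (rule evaluates_intros)+
  then show ?thesis by simp
qed

lemma evaluates_if [evaluates_intros]: "evaluates rf_if [b, m, n] (if b = 0 then n else m)"
proof (induction b)
  case 0
  have "evaluates rf_if [0, m, n] n"
    unfolding rf_if_def by (rule PrimRec_0, rule evaluates_intros)
  then show ?case by simp
next
  case (Suc b)
  have "evaluates rf_if [Suc b, m, n] m"
    unfolding rf_if_def
    by (rule PrimRec_Suc, rule Suc[unfolded rf_if_def], (rule evaluates_intros)+)
  then show ?case by simp
qed

lemma evaluates_const: "\<exists>r. \<forall>xs. evaluates r xs n"
proof (induction n)
  case (Suc n)
  then obtain r where r: "\<And>xs. evaluates r xs n" by blast
  have "evaluates (Comp Succ [r]) xs (Suc n)" for xs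
    by (rule evaluates_intros r)+
  then show ?case by blast
qed (blast intro: evaluates.Zero)

section \<open>Injective codings of data by natural numbers\<close>

class coded =
  fixes enc :: "'a \<Rightarrow> nat"
  assumes inj_enc: "inj enc"

lemma enc_eq_iff [simp]: "enc x = enc y \<longleftrightarrow> x = (y :: 'a :: coded)"
  using inj_enc by (auto dest: injD)

instantiation nat :: coded
begin
definition enc_nat :: "nat \<Rightarrow> nat" where "enc_nat n = n"
instance by standard (simp add: enc_nat_def inj_def)
end

instantiation bool :: coded
begin
definition enc_bool :: "bool \<Rightarrow> nat" where "enc_bool b = of_bool b"
instance by standard (simp add: enc_bool_def inj_def)
end

instantiation prod :: (coded, coded) coded
begin
definition enc_prod :: "'a \<times> 'b \<Rightarrow> nat" where "enc_prod p = prod_encode (enc (fst p), enc (snd p))"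
instance by standard (auto simp: enc_prod_def inj_def)
end

instantiation list :: (coded) coded
begin
definition enc_list :: "'a list \<Rightarrow> nat" where "enc_list xs = list_encode (map enc xs)"
instance
proof
  have "inj (map (enc :: 'a \<Rightarrow> nat))" using inj_enc by (simp add: inj_map)
  then show "inj (enc :: 'a list \<Rightarrow> nat)"
    by (auto simp: enc_list_def inj_def list_encode_eq)
qed
end

lemma enc_Nil [simp]: "enc [] = 0"
  by (simp add: enc_list_def)

text \<open>Head and tail are thus the components of the predecessor of the code, and emptiness is a
  test for 0.\<close>

lemma enc_Cons: "enc (x # xs) = Suc (prod_encode (enc x, enc xs))"
  by (simp add: enc_list_def)

lemma enc_eq_0_iff [simp]: "enc (xs :: 'a :: coded list) = 0 \<longleftrightarrow> xs = []"
  by (cases xs) (simp_all add: enc_Cons)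

text \<open>The recursive function is constrained only on numbers that are codes of elements; its
  behaviour elsewhere is left open.\<close>

definition computable :: "('a :: coded \<Rightarrow> 'b :: coded) \<Rightarrow> bool" where
  "computable f \<longleftrightarrow> (\<exists>r. \<forall>x. evaluates r [enc x] (enc (f x)))"

lemma computableI: "(\<And>x. evaluates r [enc x] (enc (f x))) \<Longrightarrow> computable f"
  by (auto simp: computable_def)

lemma computable_compose:
  assumes "computable f" "computable g"
  shows "computable (\<lambda>x. f (g x))"
proof -
  obtain rf rg where r: "\<And>x. evaluates rf [enc x] (enc (f x))" "\<And>x. evaluates rg [enc x] (enc (g x))"
    using assms unfolding computable_def by blast
  show ?thesis by (rule computableI[of "Comp rf [rg]"]) (rule evaluates_intros r)+
qed

text \<open>The rules below decompose \<open>\<lambda>x. t\<close> along the term \<open>t\<close>; under a binder, the context \<open>x\<close> and the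
  bound variables are passed as nested pairs.\<close>

named_theorems computable_intros

lemma computable_ident [computable_intros]: "computable (\<lambda>x. x)"
  by (rule computableI) (rule evaluates_Proj0)

lemma computable_const [computable_intros]: "computable (\<lambda>_. c)"
  using evaluates_const[of "enc c"] unfolding computable_def by blast

lemma computable_Pair [computable_intros]:
  assumes "computable f" "computable g"
  shows "computable (\<lambda>x. (f x, g x))"
proof -
  obtain rf rg where r: "\<And>x. evaluates rf [enc x] (enc (f x))" "\<And>x. evaluates rg [enc x] (enc (g x))"
    using assms unfolding computable_def by blast
  show ?thesis
    by (rule computableI[of "Comp rf_pair [rf, rg]"], simp only: enc_prod_def fst_conv snd_conv)
      (rule evaluates_intros r)+
qed

lemma computable_fst [computable_intros]: "computable f \<Longrightarrow> computable (\<lambda>x. fst (f x))"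
  by (rule computable_compose[of fst], rule computableI[of rf_fst])
    (simp add: enc_prod_def evaluates_fst)

lemma computable_snd [computable_intros]: "computable f \<Longrightarrow> computable (\<lambda>x. snd (f x))"
  by (rule computable_compose[of snd], rule computableI[of rf_snd])
    (simp add: enc_prod_def evaluates_snd)

lemma computable_if [computable_intros]:
  assumes "computable b" "computable f" "computable g"
  shows "computable (\<lambda>x. if b x then f x else g x)"
proof -
  obtain rb rf rg where r: "\<And>x. evaluates rb [enc x] (enc (b x))"
    "\<And>x. evaluates rf [enc x] (enc (f x))" "\<And>x. evaluates rg [enc x] (enc (g x))"
    using assms unfolding computable_def by blast
  have "evaluates (Comp rf_if [rb, rf, rg]) [enc x] (enc (if b x then f x else g x))" for x
    using evaluates_Comp3[OF r evaluates_if, of x] by (cases "b x") (simp_all add: enc_bool_def)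
  then show ?thesis by (rule computableI)
qed

lemma computable_enc [computable_intros]: "computable f \<Longrightarrow> computable (\<lambda>x. enc (f x))"
  by (simp add: computable_def enc_nat_def)

text \<open>With truncated subtraction, \<open>(n - m) + (m - n)\<close> vanishes exactly for equal
  codes, and subtracting it from 1 gives the truth value. Injectivity of \<open>enc\<close>
  transfers this to the encoded elements.\<close>

lemma computable_eq [computable_intros]:
  assumes "computable f" "computable g"
  shows "computable (\<lambda>x. f x = g x)"
proof -
  obtain rf rg where r: "\<And>x. evaluates rf [enc x] (enc (f x))" "\<And>x. evaluates rg [enc x] (enc (g x))"
    using assms unfolding computable_def by blast
  obtain one where one: "\<And>xs. evaluates one xs 1"
    using evaluates_const by blast
  let ?r = "Comp rf_diff [Comp rf_add [Comp rf_diff [rf, rg], Comp rf_diff [rg, rf]], one]"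
  have "evaluates ?r [enc x] (1 - (enc (g x) - enc (f x) + (enc (f x) - enc (g x))))" for x
    by (rule evaluates_intros r one)+
  moreover have "1 - (enc (g x) - enc (f x) + (enc (f x) - enc (g x))) = enc (f x = g x)" for x
  proof (cases "f x = g x")
    case False
    then have "enc (f x) \<noteq> enc (g x)" by simp
    then have "1 - (enc (g x) - enc (f x) + (enc (f x) - enc (g x))) = 0" by arith
    with False show ?thesis by (simp add: enc_bool_def)
  qed (simp add: enc_bool_def)
  ultimately show ?thesis by (auto intro: computableI)
qed

lemma computable_Not [computable_intros]:
  assumes "computable f"
  shows "computable (\<lambda>x. \<not> f x)"
proof -
  have "(\<not> b) = (if b then False else True)" for b by simp
  then show ?thesis by (simp only:) (intro computable_intros assms)
qed

lemma computable_conj [computable_intros]: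
  assumes "computable f" "computable g"
  shows "computable (\<lambda>x. f x \<and> g x)"
proof -
  have "(b \<and> c) = (if b then c else False)" for b c by simp
  then show ?thesis by (simp only:) (intro computable_intros assms)
qed

lemma computable_Cons [computable_intros]:
  assumes "computable f" "computable g"
  shows "computable (\<lambda>x. f x # g x)"
proof -
  obtain r where r: "\<And>x. evaluates r [enc x] (enc (f x, g x))"
    using computable_Pair[OF assms] unfolding computable_def by blast
  have "evaluates (Comp Succ [r]) [enc x] (Suc (enc (f x, g x)))" for x
    by (rule evaluates_intros r)+
  then show ?thesis
    by (intro computableI[of "Comp Succ [r]"]) (simp add: enc_Cons enc_prod_def)
qed

lemma computable_tl [computable_intros]:
  assumes "computable f"
  shows "computable (\<lambda>x. tl (f x))"
proof -
  have "evaluates (Comp rf_snd [rf_pred]) [enc xs] (enc (tl xs))" for xs :: "'b list"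
  proof -
    obtain m where m: "enc xs - 1 = prod_encode (m, enc (tl xs))"
    proof (cases xs)
      \<comment> \<open>The code 0 of the empty list has predecessor 0, which codes the pair (0, 0);
        its second component is again the code of the empty list.\<close>
      case Nil
      then show ?thesis using that[of 0] by (simp add: prod_encode_def)
    next
      case (Cons x ys)
      then show ?thesis using that by (simp add: enc_Cons)
    qed
    have "evaluates rf_pred [enc xs] (prod_encode (m, enc (tl xs)))"
      unfolding m[symmetric] by (rule evaluates_pred)
    then show ?thesis by (rule evaluates_Comp1) (rule evaluates_snd)
  qed
  then have "computable (tl :: 'b list \<Rightarrow> _)" by (rule computableI)
  then show ?thesis using assms by (rule computable_compose)
qed

lemma computable_hd [computable_intros]:
  assumes "computable f"
  shows "computable (\<lambda>x. hd (f x))"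
proof -
  \<comment> \<open>\<open>hd []\<close> is an unspecified but fixed element, so its code is
    supplied as a constant.\<close>
  obtain c where c: "\<And>xs. evaluates c xs (enc (hd ([] :: 'b list)))"
    using evaluates_const by blast
  have "evaluates (Comp rf_if [Proj 0, Comp rf_fst [rf_pred], c]) [enc xs] (enc (hd xs))"
    for xs :: "'b list"
  proof -
    obtain m n where mn: "enc xs - 1 = prod_encode (m, n)"
      by (metis prod_decode_inverse surj_pair)
    have "evaluates rf_pred [enc xs] (prod_encode (m, n))"
      unfolding mn[symmetric] by (rule evaluates_pred)
    then have "evaluates (Comp rf_fst [rf_pred]) [enc xs] m"
      by (rule evaluates_Comp1) (rule evaluates_fst)
    then have "evaluates (Comp rf_if [Proj 0, Comp rf_fst [rf_pred], c]) [enc xs]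
        (if enc xs = 0 then enc (hd ([] :: 'b list)) else m)"
      by (rule evaluates_Comp3[OF evaluates_Proj0 _ c evaluates_if])
    moreover have "xs \<noteq> [] \<Longrightarrow> m = enc (hd xs)"
      using mn by (cases xs) (simp_all add: enc_Cons)
    ultimately show ?thesis by (cases xs) simp_all
  qed
  then have "computable (hd :: 'b list \<Rightarrow> _)" by (rule computableI)
  then show ?thesis using assms by (rule computable_compose)
qed

lemma computable_funpow:
  fixes G :: "'a :: coded \<Rightarrow> 'b :: coded \<Rightarrow> 'b"
  assumes "computable (\<lambda>z. G (fst z) (snd z))" "computable n" "computable s"
  shows "computable (\<lambda>x. (G x ^^ n x) (s x))"
proof -
  obtain rG rn rs where r: "\<And>z. evaluates rG [enc z] (enc (G (fst z) (snd z)))"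
    "\<And>x. evaluates rn [enc x] (enc (n x))" "\<And>x. evaluates rs [enc x] (enc (s x))"
    using assms unfolding computable_def by blast
  \<comment> \<open>The step of the recursion receives the counter, the current value and the
    context, and passes the last two on as the pair (context, value).\<close>
  define step where "step = Comp rG [Comp rf_pair [Proj 2, Proj 1]]"
  have rG: "evaluates rG [prod_encode (enc x, enc y)] (enc (G x y))" for x y
    using r(1)[of "(x, y)"] by (simp add: enc_prod_def)
  have step: "evaluates step [k, enc y, enc x] (enc (G x y))" for k x y
    unfolding step_def by (rule evaluates_intros rG)+
  have iter: "evaluates (PrimRec rs step) [k, enc x] (enc ((G x ^^ k) (s x)))" for k x
  proof (induction k)
    case 0
    show ?case unfolding funpow_0 by (rule PrimRec_0, rule r)
  next
    case (Suc k)
    then show ?case using step by (auto intro: PrimRec_Suc)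
  qed
  have "evaluates (Comp (PrimRec rs step) [rn, Proj 0]) [enc x] (enc ((G x ^^ n x) (s x)))" for x
    using evaluates_Comp2[OF r(2) evaluates_Proj0] iter[of "n x" x] by (simp add: enc_nat_def)
  then show ?thesis by (rule computableI)
qed

text \<open>This makes the code of a list a ready bound on the number of steps needed to run through
  it.\<close>

lemma length_le_enc: "length xs \<le> enc xs"
proof (induction xs)
  case (Cons x xs)
  then show ?case using le_prod_encode_2[of "enc xs" "enc x"] by (simp add: enc_Cons)
qed simp

text \<open>One step of a fold, with the remaining list kept in the state. It is idle once the list
  is exhausted, so iterating it too often does no harm and a fold becomes an iteration of any
  sufficient length.\<close>

definition fold_step :: "('a \<Rightarrow> 's \<Rightarrow> 's) \<Rightarrow> 'a list \<times> 's \<Rightarrow> 'a list \<times> 's" where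
  "fold_step f st = (if fst st = [] then st else (tl (fst st), f (hd (fst st)) (snd st)))"

lemma funpow_fold_step:
  "length xs \<le> n \<Longrightarrow> (fold_step f ^^ n) (xs, s) = ([], fold f xs s)"
proof (induction n arbitrary: xs s)
  case (Suc n)
  have "(fold_step f ^^ Suc n) (xs, s) = (fold_step f ^^ n) (fold_step f (xs, s))"
    by (simp add: funpow_swap1)
  also have "\<dots> = ([], fold f xs s)"
    using Suc by (cases xs) (simp_all add: fold_step_def[of _ "(_, _)"])
  finally show ?case .
qed simp

lemma computable_fold [computable_intros]:
  assumes G: "computable (\<lambda>z. G (fst z) (fst (snd z)) (snd (snd z)))"
    and l: "computable l" and s: "computable s"
  shows "computable (\<lambda>x. fold (G x) (l x) (s x))"
proof -
  have "computable (\<lambda>z. fold_step (G (fst z)) (snd z))"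
    unfolding fold_step_def
    by (intro computable_intros
        computable_compose[OF G, where g = "\<lambda>z. (fst z, hd (fst (snd z)), snd (snd z))",
          unfolded fst_conv snd_conv])
  then have "computable (\<lambda>x. snd ((fold_step (G x) ^^ enc (l x)) (l x, s x)))"
    by (intro computable_intros computable_funpow l s)
  then show ?thesis by (simp add: funpow_fold_step length_le_enc)
qed

lemma computable_rev [computable_intros]: "computable f \<Longrightarrow> computable (\<lambda>x. rev (f x))"
  by (simp add: rev_conv_fold) (intro computable_intros)

lemma computable_foldr [computable_intros]:
  assumes "computable (\<lambda>z. G (fst z) (fst (snd z)) (snd (snd z)))" "computable l" "computable s"
  shows "computable (\<lambda>x. foldr (G x) (l x) (s x))"
  by (simp add: foldr_conv_fold) (intro computable_intros assms)

lemma computable_append [computable_intros]: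
  assumes "computable f" "computable g"
  shows "computable (\<lambda>x. f x @ g x)"
proof -
  have "computable (\<lambda>x. foldr (#) (f x) (g x))"
    by (intro computable_intros assms)
  moreover have "foldr (#) xs ys = xs @ ys" for xs ys :: "'b list"
    by (induction xs) simp_all
  ultimately show ?thesis by simp
qed

lemma computable_inv_letter [computable_intros]:
  "computable f \<Longrightarrow> computable (\<lambda>x. inv_letter (f x :: 'a :: coded letter))"
  unfolding inv_letter_def by (intro computable_intros)

lemma computable_inv_word [computable_intros]:
  assumes "computable f"
  shows "computable (\<lambda>x. inv_word (f x :: 'a :: coded word))"
proof -
  have "inv_word w = fold (\<lambda>a v. inv_letter a # v) w []" for w :: "'a word"
  proof -
    have "fold (\<lambda>a v. inv_letter a # v) w u = inv_word w @ u" for u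
      by (induction w arbitrary: u) (simp_all add: inv_word_def)
    then show ?thesis by simp
  qed
  then show ?thesis by simp (intro computable_intros assms)
qed

lemma computable_free_reduce [computable_intros]:
  assumes "computable f"
  shows "computable (\<lambda>x. free_reduce (f x :: 'a :: coded word))"
proof -
  \<comment> \<open>The pattern match is replaced by \<open>hd\<close>, \<open>tl\<close> and a
    conditional, for which closure rules exist.\<close>
  have *: "cancel_Cons = (\<lambda>(x :: 'a letter) w. if w \<noteq> [] \<and> hd w = inv_letter x then tl w else x # w)"
    (is "_ = ?c")
  proof (intro ext)
    show "cancel_Cons x w = ?c x w" for x w by (cases w) simp_all
  qed
  show ?thesis
    unfolding free_reduce_def * by (intro computable_intros assms)
qed

section \<open>Free equality and substitutions\<close>

text \<open>Equality in the free group for words that need not be reduced; loops can then be handled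
  as plain concatenations and reduced only at the end.\<close>

definition free_eq :: "'a word \<Rightarrow> 'a word \<Rightarrow> bool"  (infix "\<simeq>" 50) where
  "u \<simeq> v \<longleftrightarrow> free_reduce u = free_reduce v"

lemma free_eq_refl [simp]: "u \<simeq> u"
  by (simp add: free_eq_def)

lemma free_eq_sym: "u \<simeq> v \<Longrightarrow> v \<simeq> u"
  by (simp add: free_eq_def)

lemma free_eq_trans [trans]: "u \<simeq> v \<Longrightarrow> v \<simeq> w \<Longrightarrow> u \<simeq> w"
  by (simp add: free_eq_def)

lemma free_eq_append: "u \<simeq> u' \<Longrightarrow> v \<simeq> v' \<Longrightarrow> u @ v \<simeq> u' @ v'"
  unfolding free_eq_def by (metis free_reduce_append_left free_reduce_append_right)

lemma free_reduce_free_eq [simp]: "free_reduce w \<simeq> w"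
  by (simp add: free_eq_def free_reduce_id reduced_free_reduce)

lemma free_reduce_Nil [simp]: "free_reduce [] = []"
  by (simp add: free_reduce_def)

lemma free_reduce_Cons: "free_reduce (x # w) = cancel_Cons x (free_reduce w)"
  by (simp add: free_reduce_def)

lemma inv_word_Nil [simp]: "inv_word [] = []"
  by (simp add: inv_word_def)

lemma inv_word_append [simp]: "inv_word (u @ v) = inv_word v @ inv_word u"
  by (simp add: inv_word_def)

lemma inv_word_Cons: "inv_word (x # w) = inv_word w @ [inv_letter x]"
  by (simp add: inv_word_def)

lemma inv_word_single [simp]: "inv_word [x] = [inv_letter x]"
  by (simp add: inv_word_def)

lemma inv_word_invol [simp]: "inv_word (inv_word w) = w"
  by (induction w) (simp_all add: inv_word_Cons)

lemma inv_word_append_free_eq: "inv_word w @ w \<simeq> []"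
  by (simp add: free_eq_def free_reduce_inv_word)

lemma append_inv_word_free_eq: "w @ inv_word w \<simeq> []"
  using inv_word_append_free_eq[of "inv_word w"] by simp

text \<open>In the free group, u^-1 = u^-1 v v^-1 = u^-1 u v^-1 = v^-1.\<close>

lemma inv_word_free_eq:
  assumes "u \<simeq> v"
  shows "inv_word u \<simeq> inv_word v"
proof -
  have "inv_word u @ [] \<simeq> inv_word u @ (v @ inv_word v)"
    by (intro free_eq_append free_eq_refl free_eq_sym[OF append_inv_word_free_eq])
  also have "\<dots> \<simeq> inv_word u @ (u @ inv_word v)"
    by (intro free_eq_append free_eq_refl free_eq_sym[OF assms])
  also have "\<dots> \<simeq> [] @ inv_word v"
    using free_eq_append[OF inv_word_append_free_eq free_eq_refl] by simp
  finally show ?thesis by simp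
qed

lemma cancel_inner: "u @ v @ inv_word v @ w \<simeq> u @ w"
  using free_eq_append[OF free_eq_refl[of u] free_eq_append[OF append_inv_word_free_eq[of v] free_eq_refl[of w]]]
  by simp

lemma cancel_inner': "u @ inv_word v @ v @ w \<simeq> u @ w"
  using cancel_inner[of u "inv_word v" w] by simp

lemma reduced_free_eq: "reduced u \<Longrightarrow> reduced v \<Longrightarrow> u \<simeq> v \<longleftrightarrow> u = v"
  by (simp add: free_eq_def free_reduce_id)

definition subst_letter :: "('a \<Rightarrow> 'b word) \<Rightarrow> 'a letter \<Rightarrow> 'b word" where
  "subst_letter \<sigma> x = (if snd x then \<sigma> (fst x) else inv_word (\<sigma> (fst x)))"

definition subst :: "('a \<Rightarrow> 'b word) \<Rightarrow> 'a word \<Rightarrow> 'b word" where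
  "subst \<sigma> w = concat (map (subst_letter \<sigma>) w)"

lemma subst_simps [simp]:
  "subst \<sigma> [] = []"
  "subst \<sigma> (x # w) = subst_letter \<sigma> x @ subst \<sigma> w"
  "subst \<sigma> (u @ v) = subst \<sigma> u @ subst \<sigma> v"
  by (simp_all add: subst_def)

lemma subst_letter_inv: "subst_letter \<sigma> (inv_letter x) = inv_word (subst_letter \<sigma> x)"
  by (simp add: subst_letter_def inv_letter_def)

lemma subst_inv_word: "subst \<sigma> (inv_word w) = inv_word (subst \<sigma> w)"
  by (induction w) (simp_all add: inv_word_Cons subst_letter_inv)

lemma subst_cancel_Cons: "subst \<sigma> (cancel_Cons x w) \<simeq> subst \<sigma> (x # w)"
proof (cases w)
  case (Cons y v)
  then show ?thesis
    using cancel_inner[of "[]" "subst_letter \<sigma> x" "subst \<sigma> v"]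
    by (auto simp: subst_letter_inv intro: free_eq_sym)
qed simp

text \<open>A cancelling pair of letters is replaced by a word followed by its formal inverse. Hence
  substitution respects free equality and induces a homomorphism of free groups.\<close>

lemma subst_free_reduce: "subst \<sigma> (free_reduce w) \<simeq> subst \<sigma> w"
proof (induction w)
  case (Cons x w)
  have "subst \<sigma> (free_reduce (x # w)) \<simeq> subst_letter \<sigma> x @ subst \<sigma> (free_reduce w)"
    using subst_cancel_Cons[of \<sigma> x "free_reduce w"] by (simp add: free_reduce_Cons)
  also have "\<dots> \<simeq> subst_letter \<sigma> x @ subst \<sigma> w"
    by (intro free_eq_append free_eq_refl Cons)
  finally show ?case by simp
qed simp

lemma inv_word_letters: "w \<in> lists (letters A) \<Longrightarrow> inv_word w \<in> lists (letters A)"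
  by (induction w) (auto simp: inv_word_Cons letters_def inv_letter_def)

lemma free_reduce_letters: "w \<in> lists (letters A) \<Longrightarrow> free_reduce w \<in> lists (letters A)"
  using set_free_reduce[of w] by (auto simp: lists_eq_set)

lemma subst_letters:
  assumes "\<And>y. y \<in> Y \<Longrightarrow> \<sigma> y \<in> lists (letters A)" and "w \<in> lists (letters Y)"
  shows "subst \<sigma> w \<in> lists (letters A)"
  using assms(2)
proof (induction w)
  case (Cons x w)
  then have "fst x \<in> Y" by (auto simp: letters_def)
  then have "subst_letter \<sigma> x \<in> lists (letters A)"
    unfolding subst_letter_def using assms(1) inv_word_letters by metis
  with Cons.IH show ?case by (simp only: subst_simps append_in_lists_conv)
qed simp

definition subst_hom :: "('a \<Rightarrow> 'b word) \<Rightarrow> 'a word \<Rightarrow> 'b word" where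
  "subst_hom \<sigma> w = free_reduce (subst \<sigma> w)"

lemma subst_hom_in_hom:
  assumes "\<And>y. y \<in> Y \<Longrightarrow> \<sigma> y \<in> lists (letters A)"
  shows "subst_hom \<sigma> \<in> hom (free_group Y) (free_group A)"
proof (rule homI)
  fix w assume "w \<in> carrier (free_group Y)"
  then show "subst_hom \<sigma> w \<in> carrier (free_group A)"
    using subst_letters[of Y \<sigma> A w] assms
    by (simp add: free_group_def subst_hom_def reduced_free_reduce free_reduce_letters)
next
  fix u v
  show "subst_hom \<sigma> (u \<otimes>\<^bsub>free_group Y\<^esub> v) = subst_hom \<sigma> u \<otimes>\<^bsub>free_group A\<^esub> subst_hom \<sigma> v"
    using subst_free_reduce[of \<sigma> "u @ v"]
    by (simp add: free_group_def subst_hom_def free_eq_def free_reduce_append_left free_reduce_append_right)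
qed

section \<open>Runs of inverse transducers\<close>

definition runs :: "('q, 'a) transducer \<Rightarrow> 'q \<Rightarrow> 'a word \<Rightarrow> 'a word \<Rightarrow> 'q \<Rightarrow> bool" where
  "runs T p w u q \<longleftrightarrow> delta_word T p w = Some q \<and> lambda_word T p w = Some u"

lemma runs_Nil [simp]: "runs T p [] u q \<longleftrightarrow> u = [] \<and> q = p"
  by (auto simp: runs_def)

lemma runs_Cons:
  "runs T p (x # w) u q \<longleftrightarrow> (\<exists>a r b. (p, x, a, r) \<in> edges T \<and> runs T r w b q \<and> u = a @ b)"
  by (auto simp: runs_def edges_def Option.bind_eq_Some_conv)

lemma runs_single [simp]: "runs T p [x] u q \<longleftrightarrow> (p, x, u, q) \<in> edges T"
  by (auto simp: runs_Cons)

lemma runs_append: "runs T p v a r \<Longrightarrow> runs T r w b q \<Longrightarrow> runs T p (v @ w) (a @ b) q"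
proof (induction v arbitrary: p a)
  case (Cons x v)
  then obtain a1 s a2 where "(p, x, a1, s) \<in> edges T" "runs T s v a2 r" "a = a1 @ a2"
    by (auto simp: runs_Cons)
  with Cons show ?case by (fastforce simp: runs_Cons)
qed simp

lemma edges_deterministic:
  "(p, x, u, q) \<in> edges T \<Longrightarrow> (p, x, v, r) \<in> edges T \<Longrightarrow> u = v \<and> q = r"
  by (auto simp: edges_def)

lemma runs_deterministic: "runs T p w u q \<Longrightarrow> runs T p w v r \<Longrightarrow> u = v \<and> q = r"
  by (auto simp: runs_def)

lemma inverse_edge:
  "inverse_transducer T \<Longrightarrow> (p, x, u, q) \<in> edges T \<Longrightarrow>
    (q, inv_letter x, inv_word u, p) \<in> edges T"
  unfolding inverse_transducer_def by blast

lemma runs_inv_word: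
  assumes "inverse_transducer T"
  shows "runs T p w u q \<Longrightarrow> runs T q (inv_word w) (inv_word u) p"
proof (induction w arbitrary: p u)
  case (Cons x w)
  then obtain a r b where e: "(p, x, a, r) \<in> edges T" "runs T r w b q" "u = a @ b"
    by (auto simp: runs_Cons)
  have "runs T q (inv_word w @ [inv_letter x]) (inv_word b @ inv_word a) p"
    by (rule runs_append[OF Cons.IH[OF e(2)]]) (simp add: inverse_edge assms e(1))
  then show ?case by (simp add: inv_word_Cons e(3))
qed simp

text \<open>Reading a letter and then its inverse crosses an edge and, by determinism, the same edge
  backwards. Cancelling the pair keeps the end state and removes from the output a word followed by
  its formal inverse.\<close>

lemma runs_free_reduce:
  assumes "inverse_transducer T"
  shows "runs T p w u q \<Longrightarrow> \<exists>v. runs T p (free_reduce w) v q \<and> v \<simeq> u"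
proof (induction w arbitrary: p u)
  case (Cons x w)
  then obtain a r b where e: "(p, x, a, r) \<in> edges T" "runs T r w b q" "u = a @ b"
    by (auto simp: runs_Cons)
  obtain v where v: "runs T r (free_reduce w) v q" "v \<simeq> b"
    using Cons.IH[OF e(2)] by blast
  show ?case
  proof (cases "\<exists>w'. free_reduce w = inv_letter x # w'")
    case True
    then obtain w' where w': "free_reduce w = inv_letter x # w'" by blast
    with v(1) obtain c s d where c: "(r, inv_letter x, c, s) \<in> edges T" "runs T s w' d q" "v = c @ d"
      by (auto simp: runs_Cons)
    have cs: "c = inv_word a \<and> s = p"
      using edges_deterministic[OF c(1) inverse_edge[OF assms e(1)]] .
    have "d \<simeq> a @ v"
      using cancel_inner[of "[]" a d] cs c(3) by (auto intro: free_eq_sym)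
    also have "\<dots> \<simeq> u" using free_eq_append[OF free_eq_refl v(2)] e(3) by blast
    finally show ?thesis using cs c(2) w' by (auto simp: free_reduce_Cons)
  next
    case False
    then have "free_reduce (x # w) = x # free_reduce w"
      by (cases "free_reduce w") (auto simp: free_reduce_Cons)
    moreover have "runs T p (x # free_reduce w) (a @ v) q" using e(1) v(1) by (auto simp: runs_Cons)
    moreover have "a @ v \<simeq> u" using free_eq_append[OF free_eq_refl v(2)] e(3) by blast
    ultimately show ?thesis by auto
  qed
qed simp

text \<open>Both runs can be replaced by the run along the common reduced word, which is unique. The
  output thus depends only on the group element read.\<close>

lemma runs_free_eq:
  assumes "inverse_transducer T" "runs T p v a q" "runs T p w b r" "v \<simeq> w"
  shows "a \<simeq> b"
proof -
  obtain a' where a': "runs T p (free_reduce v) a' q" "a' \<simeq> a"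
    using runs_free_reduce[OF assms(1,2)] by blast
  obtain b' where b': "runs T p (free_reduce w) b' r" "b' \<simeq> b"
    using runs_free_reduce[OF assms(1,3)] by blast
  have "free_reduce v = free_reduce w" using assms(4) by (simp add: free_eq_def)
  then have "a' = b'" using runs_deterministic[OF a'(1)] b'(1) by simp
  with a'(2) b'(2) show ?thesis by (simp add: free_eq_def)
qed

lemma runs_letters:
  assumes "transducer_over A T"
  shows "runs T p w u q \<Longrightarrow> w \<in> lists (letters A) \<and> u \<in> lists (letters A)"
proof (induction w arbitrary: p u)
  case (Cons x w)
  then obtain a r b where e: "(p, x, a, r) \<in> edges T" "runs T r w b q" "u = a @ b"
    by (auto simp: runs_Cons)
  then have "delta T p x = Some r" "lambda T p x = Some a" by (simp_all add: edges_def)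
  then have "x \<in> letters A" "a \<in> lists (letters A)"
    using assms unfolding transducer_over_def by blast+
  with Cons.IH[OF e(2)] e(3) show ?case by auto
qed simp

section \<open>The basis given by a spanning tree\<close>

text \<open>\<open>V\<close> is the set of states reachable from the initial one, \<open>W p\<close>
  the tree path to \<open>p\<close> and \<open>U p\<close> the output along it. The tree itself is
  present only through \<open>parent\<close>: each path prolongs the path of a neighbour by one
  edge. The map \<open>name\<close> turns edges into generator symbols.\<close>

locale spanning_tree =
  fixes A :: "'a set" and T :: "('q, 'a) transducer"
    and V :: "'q set" and W :: "'q \<Rightarrow> 'a word" and U :: "'q \<Rightarrow> 'a word"
    and name :: "'q \<times> 'a letter \<times> 'a word \<times> 'q \<Rightarrow> 'a"
  assumes over: "transducer_over A T" and inverse: "inverse_transducer T"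
    and init_V: "init T \<in> V" and W_init: "W (init T) = []" and U_init: "U (init T) = []"
    and W_runs: "p \<in> V \<Longrightarrow> runs T (init T) (W p) (U p) p"
    and V_closed: "p \<in> V \<Longrightarrow> (p, x, u, q) \<in> edges T \<Longrightarrow> q \<in> V"
    and parent: "p \<in> V \<Longrightarrow> p \<noteq> init T \<Longrightarrow>
      \<exists>p' x u. p' \<in> V \<and> (p', x, u, p) \<in> edges T \<and> W p = W p' @ [x]"
    and inj_name: "inj name"
begin

section \<open>The generators and the loops they stand for\<close>

definition loop :: "'q \<times> 'a letter \<times> 'a word \<times> 'q \<Rightarrow> 'a word" where
  "loop = (\<lambda>(p, x, u, q). W p @ [x] @ inv_word (W q))"

definition loop_out :: "'q \<times> 'a letter \<times> 'a word \<times> 'q \<Rightarrow> 'a word" where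
  "loop_out = (\<lambda>(p, x, u, q). U p @ u @ inv_word (U q))"

text \<open>Negative edges yield the inverses of the loops of positive ones. Tree edges yield loops
  that reduce to the empty word, so a test on the loop excludes them and the edges of the tree need
  not be recorded.\<close>

definition gens :: "('q \<times> 'a letter \<times> 'a word \<times> 'q) set" where
  "gens = {(p, x, u, q) \<in> edges T. p \<in> V \<and> snd x \<and> free_reduce (loop (p, x, u, q)) \<noteq> []}"

abbreviation "Y \<equiv> name ` gens"

definition edge_of where "edge_of = inv_into UNIV name"

text \<open>Versions on words, without reduction, so that the transducer can be run along
  \<open>h w\<close> letter by letter.\<close>

definition h where "h = subst (\<lambda>y. loop (edge_of y))"
definition g where "g = subst (\<lambda>y. loop_out (edge_of y))"

definition gen_word where "gen_word e = (if e \<in> gens then [(name e, True)] else [])"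

definition token where
  "token = (\<lambda>(p, x, u, q). if snd x then gen_word (p, x, u, q)
     else inv_word (gen_word (q, inv_letter x, inv_word u, p)))"

text \<open>Replacing the outputs of \<^term>\<open>T\<close> by the names of the generators that are crossed gives
  an inverse transducer, whose run along \<^term>\<open>h w\<close> recovers \<^term>\<open>w\<close>.\<close>

definition T' :: "('q, 'a) transducer" where
  "T' = T\<lparr>lambda := \<lambda>p x. map_option (\<lambda>u. token (p, x, u, the (delta T p x))) (lambda T p x)\<rparr>"

lemma edges_T': "(p, x, t, q) \<in> edges T' \<longleftrightarrow> (\<exists>u. (p, x, u, q) \<in> edges T \<and> t = token (p, x, u, q))"
  by (auto simp: edges_def T'_def)

lemma token_inv: "token (q, inv_letter x, inv_word u, p) = inv_word (token (p, x, u, q))"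
  by (simp add: token_def) (simp add: inv_letter_def)

lemma inverse_T': "inverse_transducer T'"
proof -
  have "(q, inv_letter x, inv_word t, p) \<in> edges T'" if "(p, x, t, q) \<in> edges T'" for p x t q
  proof -
    obtain u where "(p, x, u, q) \<in> edges T" "t = token (p, x, u, q)"
      using \<open>(p, x, t, q) \<in> edges T'\<close> by (auto simp: edges_T')
    then show ?thesis
      unfolding edges_T' by (intro exI[of _ "inv_word u"]) (simp add: inverse_edge inverse token_inv)
  qed
  \<comment> \<open>The converse implication is the same claim for the reversed edge, since
    inversion is an involution.\<close>
  from this this[of _ "inv_letter _" "inv_word _"] show ?thesis
    unfolding inverse_transducer_def by (metis inv_letter_invol inv_word_invol)
qed

text \<open>Tree paths cross no generator. By induction on the length of the path, only its last
  edge has to be considered; the loops of both orientations of that edge have the form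
  \<open>W p @ inv_word (W p)\<close>, so neither orientation is in \<open>gens\<close>.\<close>

lemma W_runs_T': "p \<in> V \<Longrightarrow> runs T' (init T) (W p) [] p"
proof (induction "length (W p)" arbitrary: p rule: less_induct)
  case less
  show ?case
  proof (cases "p = init T")
    case False
    with less.prems obtain p' x u where e: "p' \<in> V" "(p', x, u, p) \<in> edges T" "W p = W p' @ [x]"
      using parent by blast
    have "loop (p', x, u, p) = W p @ inv_word (W p)"
      "loop (p, inv_letter x, inv_word u, p') = W p @ inv_word (W p)"
      by (simp_all add: loop_def e(3))
    then have "(p', x, u, p) \<notin> gens" "(p, inv_letter x, inv_word u, p') \<notin> gens"
      using append_inv_word_free_eq[of "W p"] by (auto simp: gens_def free_eq_def)
    then have "token (p', x, u, p) = []"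
      by (simp add: token_def gen_word_def)
    then have "runs T' p' [x] [] p" using e(2) by (auto simp: edges_T')
    moreover have "runs T' (init T) (W p') [] p'" using less.hyps e by simp
    ultimately show ?thesis using runs_append e(3) by fastforce
  qed (simp add: W_init)
qed

lemma loop_runs:
  assumes "(p, x, u, q) \<in> edges T" "p \<in> V"
  shows "runs T (init T) (loop (p, x, u, q)) (loop_out (p, x, u, q)) (init T)"
proof -
  have "q \<in> V" using V_closed assms by blast
  show ?thesis unfolding loop_def loop_out_def prod.case
    by (intro runs_append[OF W_runs[OF assms(2)]] runs_append[of T p _ _ q]
        runs_inv_word inverse W_runs \<open>q \<in> V\<close>) (simp add: assms)
qed

text \<open>The tree paths at both ends contribute nothing, so only the middle edge is
  recorded.\<close>

lemma loop_runs_T':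
  assumes "(p, x, u, q) \<in> gens"
  shows "runs T' (init T) (loop (p, x, u, q)) [(name (p, x, u, q), True)] (init T)"
proof -
  have e: "(p, x, u, q) \<in> edges T" "p \<in> V" "snd x" using assms by (auto simp: gens_def)
  then have "q \<in> V" using V_closed by blast
  have "runs T' p [x] [(name (p, x, u, q), True)] q"
    using e assms by (auto simp: edges_T' token_def gen_word_def)
  then have "runs T' (init T) (loop (p, x, u, q)) ([] @ [(name (p, x, u, q), True)] @ inv_word []) (init T)"
    unfolding loop_def prod.case
    by (intro runs_append[OF W_runs_T'[OF e(2)]] runs_append[of T' p _ _ q]
        runs_inv_word inverse_T' W_runs_T' \<open>q \<in> V\<close>)
  then show ?thesis by simp
qed

lemma edge_of_name: "edge_of (name e) = e"
  using inj_name by (simp add: edge_of_def)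

text \<open>Each letter contributes a loop at the initial state, traversed backwards for an inverse
  letter, and these runs concatenate. In \<open>T'\<close> the output is literally \<open>w\<close>,
  even if \<open>w\<close> is not reduced.\<close>

lemma h_runs:
  "w \<in> lists (letters Y) \<Longrightarrow>
    runs T (init T) (h w) (g w) (init T) \<and> runs T' (init T) (h w) w (init T)"
proof (induction w)
  case (Cons y w)
  then obtain p x u q b where e: "(p, x, u, q) \<in> gens" and y: "y = (name (p, x, u, q), b)"
    by (auto simp: letters_def)
  let ?l = "\<lambda>y. loop (edge_of y)" and ?o = "\<lambda>y. loop_out (edge_of y)"
  have T: "runs T (init T) (loop (p, x, u, q)) (loop_out (p, x, u, q)) (init T)"
    using e by (intro loop_runs) (auto simp: gens_def)
  note T' = loop_runs_T'[OF e]
  have "runs T (init T) (subst_letter ?l y) (subst_letter ?o y) (init T)"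
    using T runs_inv_word[OF inverse T] by (cases b) (simp_all add: y subst_letter_def edge_of_name)
  moreover have "runs T' (init T) (subst_letter ?l y) [y] (init T)"
    using T' runs_inv_word[OF inverse_T' T']
    by (cases b) (simp_all add: y subst_letter_def edge_of_name inv_letter_def del: runs_single)
  ultimately show ?case
    using Cons runs_append[of T "init T"] runs_append[of T' "init T" _ "[y]"]
    by (auto simp: h_def g_def)
qed (simp add: h_def g_def)

text \<open>The output of \<open>T'\<close> along \<open>h v\<close> is \<open>v\<close>, and freely
  equal inputs have freely equal outputs. This is the injectivity of \<open>h\<close> on the free
  group.\<close>

lemma h_free_eq_D:
  assumes "v \<in> lists (letters Y)" "w \<in> lists (letters Y)" "h v \<simeq> h w"
  shows "v \<simeq> w"
  using runs_free_eq[OF inverse_T' conjunct2[OF h_runs] conjunct2[OF h_runs]] assms by blast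

text \<open>A positive edge outside \<open>gens\<close> has a trivial loop; comparison with the
  empty run shows that its output is trivial too, so the empty word serves for both maps. A negative
  edge is treated by inverting the word found for its reverse.\<close>

lemma loop_generated:
  assumes "(p, x, u, q) \<in> edges T" "p \<in> V"
  shows "\<exists>v\<in>lists (letters Y). h v \<simeq> loop (p, x, u, q) \<and> g v \<simeq> loop_out (p, x, u, q)"
proof -
  have pos: "\<exists>v\<in>lists (letters Y). h v \<simeq> loop (p, x, u, q) \<and> g v \<simeq> loop_out (p, x, u, q)"
    if e: "(p, x, u, q) \<in> edges T" "p \<in> V" "snd x" for p x u q
  proof (cases "(p, x, u, q) \<in> gens")
    case True
    then show ?thesis
      by (intro bexI[of _ "[(name (p, x, u, q), True)]"])
        (auto simp: h_def g_def subst_letter_def edge_of_name letters_def)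
  next
    case False
    then have "loop (p, x, u, q) \<simeq> []" using e by (auto simp: gens_def free_eq_def)
    moreover from this have "loop_out (p, x, u, q) \<simeq> []"
      using runs_free_eq[OF inverse loop_runs[OF e(1,2)], of "[]"] by auto
    ultimately show ?thesis
      by (intro bexI[of _ "[]"]) (auto simp: h_def g_def intro: free_eq_sym)
  qed
  show ?thesis
  proof (cases "snd x")
    case False
    have "q \<in> V" using V_closed assms by blast
    moreover have "snd (inv_letter x)" using False by (simp add: inv_letter_def)
    ultimately obtain v where v: "v \<in> lists (letters Y)"
      "h v \<simeq> loop (q, inv_letter x, inv_word u, p)" "g v \<simeq> loop_out (q, inv_letter x, inv_word u, p)"
      using pos inverse_edge[OF inverse assms(1)] by metis
    have "inv_word (loop (q, inv_letter x, inv_word u, p)) = loop (p, x, u, q)"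
      "inv_word (loop_out (q, inv_letter x, inv_word u, p)) = loop_out (p, x, u, q)"
      by (simp_all add: loop_def loop_out_def inv_word_Cons)
    with v(2,3)[THEN inv_word_free_eq]
    have "h (inv_word v) \<simeq> loop (p, x, u, q)" "g (inv_word v) \<simeq> loop_out (p, x, u, q)"
      by (simp_all only: h_def g_def subst_inv_word)
    with v(1) inv_word_letters show ?thesis by blast
  qed (use pos assms in blast)
qed

text \<open>The loops of consecutive edges telescope: at each intermediate state \<open>r\<close>
  the factor \<open>inv_word (W r) @ W r\<close> cancels, and likewise for \<open>U\<close>. Applied
  to a run from the initial state to itself, this shows that the generators generate all loops, with
  \<open>g\<close> giving the outputs.\<close>

lemma runs_generated:
  "runs T p w u q \<Longrightarrow> p \<in> V \<Longrightarrow>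
    \<exists>v\<in>lists (letters Y). h v \<simeq> W p @ w @ inv_word (W q) \<and> g v \<simeq> U p @ u @ inv_word (U q)"
proof (induction w arbitrary: p u)
  case Nil
  then show ?case
    by (intro bexI[of _ "[]"])
      (auto simp: h_def g_def intro: free_eq_sym append_inv_word_free_eq)
next
  case (Cons x w)
  then obtain a r b where e: "(p, x, a, r) \<in> edges T" "runs T r w b q" "u = a @ b"
    by (auto simp: runs_Cons)
  have r: "r \<in> V" using V_closed e Cons.prems by blast
  obtain v1 where v1: "v1 \<in> lists (letters Y)" "h v1 \<simeq> loop (p, x, a, r)" "g v1 \<simeq> loop_out (p, x, a, r)"
    using loop_generated[OF e(1)] Cons.prems by blast
  obtain v2 where v2: "v2 \<in> lists (letters Y)" "h v2 \<simeq> W r @ w @ inv_word (W q)"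
    "g v2 \<simeq> U r @ b @ inv_word (U q)"
    using Cons.IH[OF e(2) r] by blast
  have "h (v1 @ v2) \<simeq> W p @ (x # w) @ inv_word (W q)"
    using free_eq_trans[OF free_eq_append[OF v1(2) v2(2)], of "W p @ (x # w) @ inv_word (W q)"]
      cancel_inner'[of "W p @ [x]" "W r" "w @ inv_word (W q)"]
    by (simp add: h_def loop_def)
  moreover have "g (v1 @ v2) \<simeq> U p @ u @ inv_word (U q)"
    using free_eq_trans[OF free_eq_append[OF v1(3) v2(3)], of "U p @ u @ inv_word (U q)"]
      cancel_inner'[of "U p @ a" "U r" "b @ inv_word (U q)"]
    by (simp add: g_def loop_out_def e(3))
  ultimately show ?case using v1(1) v2(1) by (intro bexI[of _ "v1 @ v2"]) auto
qed

section \<open>The two homomorphisms and their equalizer\<close>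

definition hom_g where "hom_g = subst_hom (\<lambda>y. loop_out (edge_of y))"
definition hom_h where "hom_h = subst_hom (\<lambda>y. loop (edge_of y))"

lemma hom_h_eq: "hom_h w = free_reduce (h w)" and hom_g_eq: "hom_g w = free_reduce (g w)"
  by (simp_all add: hom_h_def hom_g_def subst_hom_def h_def g_def)

lemma loop_letters: "e \<in> gens \<Longrightarrow> loop e \<in> lists (letters A) \<and> loop_out e \<in> lists (letters A)"
  using runs_letters[OF over loop_runs] by (cases e) (auto simp: gens_def)

lemma hom_g_in_hom: "hom_g \<in> hom (free_group Y) (free_group A)"
  unfolding hom_g_def by (rule subst_hom_in_hom) (metis imageE edge_of_name loop_letters)

lemma hom_h_in_hom: "hom_h \<in> hom (free_group Y) (free_group A)"
  unfolding hom_h_def by (rule subst_hom_in_hom) (metis imageE edge_of_name loop_letters)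

lemma inj_on_hom_h: "inj_on hom_h (carrier (free_group Y))"
proof (rule inj_onI)
  fix v w
  assume "v \<in> carrier (free_group Y)" "w \<in> carrier (free_group Y)" "hom_h v = hom_h w"
  then have "v \<in> lists (letters Y)" "reduced v" "w \<in> lists (letters Y)" "reduced w" "h v \<simeq> h w"
    by (simp_all add: free_group_def hom_h_eq free_eq_def)
  with h_free_eq_D have "v \<simeq> w" by blast
  with \<open>reduced v\<close> \<open>reduced w\<close> show "v = w" by (simp add: reduced_free_eq)
qed

text \<open>The fixed loop is \<open>hom_h v\<close>: the run along \<open>h v\<close> has output
  \<open>g v\<close>, and reducing the input changes neither the end state nor the output up to free
  equality. It is nontrivial because \<open>h\<close> is injective.\<close>

lemma equalizer_imp_fixed_loop:
  assumes v: "v \<in> equalizer (free_group Y) hom_g hom_h" "v \<noteq> []"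
  shows "\<exists>w. fixed_loop A T w \<and> w \<noteq> []"
proof (intro exI conjI)
  have vY: "v \<in> lists (letters Y)" "reduced v" and eq: "hom_g v = hom_h v"
    using v(1) by (simp_all add: equalizer_def free_group_def)
  have r: "runs T (init T) (h v) (g v) (init T)" using h_runs[OF vY(1)] by (rule conjunct1)
  obtain u where u: "runs T (init T) (free_reduce (h v)) u (init T)" "u \<simeq> g v"
    using runs_free_reduce[OF inverse r] by blast
  from u(2) have "free_reduce u = free_reduce (h v)"
    using eq by (simp add: free_eq_def hom_h_eq hom_g_eq)
  moreover have "free_reduce (h v) \<in> lists (letters A)"
    using runs_letters[OF over u(1)] by blast
  ultimately show "fixed_loop A T (hom_h v)"
    using u(1) unfolding runs_def
    by (simp add: fixed_loop_def free_group_def transducer_map_def hom_h_eq reduced_free_reduce)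
  show "hom_h v \<noteq> []"
  proof
    assume "hom_h v = []"
    then have "h v \<simeq> h []" by (simp add: hom_h_eq h_def free_eq_def)
    then have "v \<simeq> []" using h_free_eq_D[OF vY(1), of "[]"] by simp
    then show False using v(2) vY(2) by (simp add: reduced_free_eq)
  qed
qed

lemma fixed_loop_imp_equalizer:
  assumes "fixed_loop A T w" "w \<noteq> []"
  shows "\<exists>v. v \<in> equalizer (free_group Y) hom_g hom_h \<and> v \<noteq> []"
proof -
  obtain u where u: "runs T (init T) w u (init T)" "free_reduce u = w" and w: "reduced w"
    using assms(1) by (auto simp: fixed_loop_def transducer_map_def runs_def free_group_def)
  \<comment> \<open>The run starts and ends at the initial state, where \<open>W\<close> and
    \<open>U\<close> are empty, so the surrounding tree paths disappear.\<close>
  obtain v where v: "v \<in> lists (letters Y)" "h v \<simeq> w" "g v \<simeq> u"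
    using runs_generated[OF u(1) init_V] by (auto simp: W_init U_init)
  let ?v = "free_reduce v"
  have h: "hom_h ?v = w"
    using subst_free_reduce v(2) w by (metis h_def hom_h_eq free_eq_def free_reduce_id)
  moreover have "hom_g ?v = w"
    using subst_free_reduce v(3) u(2) by (metis g_def hom_g_eq free_eq_def)
  ultimately have "?v \<in> equalizer (free_group Y) hom_g hom_h"
    using v(1) by (simp add: equalizer_def free_group_def reduced_free_reduce free_reduce_letters)
  moreover have "?v \<noteq> []" using h assms(2) by (auto simp: hom_h_eq h_def)
  ultimately show ?thesis by blast
qed

lemma equalizer_nontrivial_iff:
  "equalizer (free_group Y) hom_g hom_h \<noteq> {\<one>\<^bsub>free_group Y\<^esub>} \<longleftrightarrow>
    (\<exists>w. fixed_loop A T w \<and> w \<noteq> \<one>\<^bsub>free_group A\<^esub>)"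
proof -
  have "[] \<in> equalizer (free_group Y) hom_g hom_h"
    by (simp add: equalizer_def free_group_def hom_g_eq hom_h_eq g_def h_def)
  then have "equalizer (free_group Y) hom_g hom_h \<noteq> {[]} \<longleftrightarrow>
      (\<exists>v. v \<in> equalizer (free_group Y) hom_g hom_h \<and> v \<noteq> [])"
    by auto
  then show ?thesis
    using equalizer_imp_fixed_loop fixed_loop_imp_equalizer by (auto simp: free_group_def)
qed

end

section \<open>The algorithm\<close>

text \<open>Used for projections out of records stored as lists of numbers, where a structured field
  is held as its code.\<close>

lemma computable_of_enc: "computable (\<lambda>x. enc (f x)) \<Longrightarrow> computable f"
  by (simp add: computable_def enc_nat_def)

lemma computable_map [computable_intros]:
  assumes "computable (\<lambda>z. f (fst z) (snd z))" "computable l"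
  shows "computable (\<lambda>x. map (f x) (l x))"
proof -
  have "map k xs = foldr (\<lambda>a ys. k a # ys) xs []" for k :: "'b \<Rightarrow> 'c" and xs
    by (induction xs) simp_all
  then show ?thesis
    by (simp only:) (intro computable_intros assms
        computable_compose[OF assms(1), where g = "\<lambda>z. (fst z, fst (snd z))", unfolded fst_conv snd_conv])
qed

lemma computable_filter [computable_intros]:
  assumes "computable (\<lambda>z. P (fst z) (snd z))" "computable l"
  shows "computable (\<lambda>x. filter (P x) (l x))"
proof -
  have "filter R xs = foldr (\<lambda>a ys. if R a then a # ys else ys) xs []" for R :: "'b \<Rightarrow> bool" and xs
    by (induction xs) simp_all
  then show ?thesis
    by (simp only:) (intro computable_intros assms
        computable_compose[OF assms(1), where g = "\<lambda>z. (fst z, fst (snd z))", unfolded fst_conv snd_conv])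
qed

section \<open>Agreement of the codings with the presentation of inputs and outputs\<close>

lemma letter_code_eq_enc: "letter_code = enc"
  by (simp add: fun_eq_iff letter_code_def enc_prod_def enc_nat_def enc_bool_def)

lemma word_code_eq_enc: "word_code = enc"
  by (simp add: fun_eq_iff word_code_def enc_list_def letter_code_eq_enc)

lemma list_encode_eq_enc: "list_encode = enc"
proof -
  have "map enc ns = ns" for ns :: "nat list" by (simp add: enc_nat_def map_idI)
  then show ?thesis by (simp add: fun_eq_iff enc_list_def)
qed

lemma enc_map_enc: "enc (map enc xs) = enc xs"
  by (simp add: enc_list_def enc_nat_def comp_def)

text \<open>Separate datatypes are used because their codes have to be lists of fields, as in
  \<open>edge_code\<close> and in the encodings of transducers and homomorphism pairs; the coding of
  tuples by nested pairs gives different numbers.\<close>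

datatype edge = Edge (src: nat) (lab: "nat letter") (out: "nat word") (tgt: nat)
datatype input = Input (alphabet: "nat list") (state_list: "nat list") (start: nat) (edge_list: "edge list")
datatype generator = Generator (generator_name: nat) (generator_g: "nat word") (generator_h: "nat word")

definition edge_tuple :: "edge \<Rightarrow> nat \<times> nat letter \<times> nat word \<times> nat" where
  "edge_tuple e = (src e, lab e, out e, tgt e)"

definition edge_fields :: "edge \<Rightarrow> nat list" where
  "edge_fields e = [src e, enc (lab e), enc (out e), tgt e]"

instantiation edge :: coded
begin
definition enc_edge :: "edge \<Rightarrow> nat" where "enc_edge e = enc (edge_fields e)"
instance by standard (auto simp: enc_edge_def edge_fields_def inj_def intro: edge.expand)
end

definition input_fields :: "input \<Rightarrow> nat list" where
  "input_fields i = [enc (alphabet i), enc (state_list i), start i, enc (edge_list i)]"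

instantiation input :: coded
begin
definition enc_input :: "input \<Rightarrow> nat" where "enc_input i = enc (input_fields i)"
instance by standard (auto simp: enc_input_def input_fields_def inj_def intro: input.expand)
end

definition generator_fields :: "generator \<Rightarrow> nat list" where
  "generator_fields y = [generator_name y, enc (generator_g y), enc (generator_h y)]"

instantiation generator :: coded
begin
definition enc_generator :: "generator \<Rightarrow> nat" where "enc_generator y = enc (generator_fields y)"
instance by standard (auto simp: enc_generator_def generator_fields_def inj_def intro: generator.expand)
end

lemma edge_code_edge_tuple: "edge_code (edge_tuple e) = enc e"
  by (simp add: edge_code_def edge_tuple_def enc_edge_def edge_fields_def letter_code_eq_enc
      word_code_eq_enc list_encode_eq_enc)

text \<open>The code of an edge serves as the name of its generator.\<close>

lemma inj_edge_code: "inj edge_code"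
  by (auto simp: inj_def edge_code_def letter_code_eq_enc word_code_eq_enc list_encode_eq)

lemma computable_edge_fields [computable_intros]:
  "computable f \<Longrightarrow> computable (\<lambda>x. edge_fields (f x))"
  by (simp add: computable_def enc_edge_def)

lemma computable_input_fields [computable_intros]:
  "computable f \<Longrightarrow> computable (\<lambda>x. input_fields (f x))"
  by (simp add: computable_def enc_input_def)

lemma computable_Generator [computable_intros]:
  assumes "computable f" "computable g" "computable h"
  shows "computable (\<lambda>x. Generator (f x) (g x) (h x))"
proof -
  have "computable (\<lambda>x. [f x, enc (g x), enc (h x)])"
    by (intro computable_intros assms)
  then show ?thesis by (simp add: computable_def enc_generator_def generator_fields_def)
qed

lemma computable_src [computable_intros]: "computable f \<Longrightarrow> computable (\<lambda>x. src (f x))"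
  by (drule computable_edge_fields, drule computable_hd) (simp add: edge_fields_def)

lemma computable_lab [computable_intros]: "computable f \<Longrightarrow> computable (\<lambda>x. lab (f x))"
  by (rule computable_of_enc, drule computable_edge_fields, drule computable_tl, drule computable_hd)
    (simp add: edge_fields_def)

lemma computable_out [computable_intros]: "computable f \<Longrightarrow> computable (\<lambda>x. out (f x))"
  by (rule computable_of_enc, drule computable_edge_fields, drule computable_tl, drule computable_tl,
      drule computable_hd) (simp add: edge_fields_def)

lemma computable_tgt [computable_intros]: "computable f \<Longrightarrow> computable (\<lambda>x. tgt (f x))"
  by (drule computable_edge_fields, drule computable_tl, drule computable_tl, drule computable_tl,
      drule computable_hd) (simp add: edge_fields_def)

lemma computable_state_list [computable_intros]:
  "computable f \<Longrightarrow> computable (\<lambda>x. state_list (f x))"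
  by (rule computable_of_enc, drule computable_input_fields, drule computable_tl, drule computable_hd)
    (simp add: input_fields_def)

lemma computable_start [computable_intros]: "computable f \<Longrightarrow> computable (\<lambda>x. start (f x))"
  by (drule computable_input_fields, drule computable_tl, drule computable_tl, drule computable_hd)
    (simp add: input_fields_def)

lemma computable_edge_list [computable_intros]:
  "computable f \<Longrightarrow> computable (\<lambda>x. edge_list (f x))"
  by (rule computable_of_enc, drule computable_input_fields, drule computable_tl, drule computable_tl,
      drule computable_tl, drule computable_hd) (simp add: input_fields_def)

text \<open>A table lists the states reached so far, each with a path from the initial state and the
  output along that path.\<close>

type_synonym table = "(nat \<times> nat word \<times> nat word) list"

definition visited :: "table \<Rightarrow> nat \<Rightarrow> bool" where
  "visited t p = foldr (\<lambda>r b. if fst r = p then True else b) t False"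

definition lookup :: "table \<Rightarrow> nat \<Rightarrow> nat word \<times> nat word" where
  "lookup t p = foldr (\<lambda>r v. if fst r = p then snd r else v) t ([], [])"

definition extend :: "edge \<Rightarrow> table \<Rightarrow> table" where
  "extend e t =
    (if visited t (src e) \<and> \<not> visited t (tgt e)
     then (tgt e, fst (lookup t (src e)) @ [lab e], snd (lookup t (src e)) @ out e) # t else t)"

definition sweep :: "edge list \<Rightarrow> table \<Rightarrow> table" where
  "sweep es t = fold extend es t"

text \<open>The list of states acts as a counter: one sweep over all edges is made per
  entry.\<close>

definition table :: "input \<Rightarrow> table" where
  "table i = fold (\<lambda>_. sweep (edge_list i)) (state_list i) [(start i, [], [])]"

definition loop_of :: "table \<Rightarrow> edge \<Rightarrow> nat word" where
  "loop_of t e = fst (lookup t (src e)) @ [lab e] @ inv_word (fst (lookup t (tgt e)))"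

definition loop_out_of :: "table \<Rightarrow> edge \<Rightarrow> nat word" where
  "loop_out_of t e = snd (lookup t (src e)) @ out e @ inv_word (snd (lookup t (tgt e)))"

definition is_generator :: "table \<Rightarrow> edge \<Rightarrow> bool" where
  "is_generator t e \<longleftrightarrow> visited t (src e) \<and> snd (lab e) \<and> free_reduce (loop_of t e) \<noteq> []"

definition generators :: "input \<Rightarrow> generator list" where
  "generators i = map (\<lambda>e. Generator (enc e) (free_reduce (loop_out_of (table i) e))
      (free_reduce (loop_of (table i) e))) (filter (is_generator (table i)) (edge_list i))"

lemma computable_visited [computable_intros]:
  "computable t \<Longrightarrow> computable p \<Longrightarrow> computable (\<lambda>x. visited (t x) (p x))"
  \<comment> \<open>Below the binder of \<open>foldr\<close>, \<open>p\<close> is evaluated at the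
    context, which is the first component of the nested pair.\<close>
  unfolding visited_def by (intro computable_intros computable_compose[of p fst])

lemma computable_lookup [computable_intros]:
  "computable t \<Longrightarrow> computable p \<Longrightarrow> computable (\<lambda>x. lookup (t x) (p x))"
  unfolding lookup_def by (intro computable_intros computable_compose[of p fst])

lemma computable_extend [computable_intros]:
  "computable e \<Longrightarrow> computable t \<Longrightarrow> computable (\<lambda>x. extend (e x) (t x))"
  unfolding extend_def by (intro computable_intros)

lemma computable_sweep [computable_intros]:
  "computable es \<Longrightarrow> computable t \<Longrightarrow> computable (\<lambda>x. sweep (es x) (t x))"
  unfolding sweep_def by (intro computable_intros)

lemma computable_table [computable_intros]: "computable i \<Longrightarrow> computable (\<lambda>x. table (i x))"
  unfolding table_def by (intro computable_intros computable_compose[of i fst])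

lemma computable_loop_of [computable_intros]:
  "computable t \<Longrightarrow> computable e \<Longrightarrow> computable (\<lambda>x. loop_of (t x) (e x))"
  unfolding loop_of_def by (intro computable_intros)

lemma computable_loop_out_of [computable_intros]:
  "computable t \<Longrightarrow> computable e \<Longrightarrow> computable (\<lambda>x. loop_out_of (t x) (e x))"
  unfolding loop_out_of_def by (intro computable_intros)

lemma computable_is_generator [computable_intros]:
  "computable t \<Longrightarrow> computable e \<Longrightarrow> computable (\<lambda>x. is_generator (t x) (e x))"
  unfolding is_generator_def by (intro computable_intros)

lemma computable_generators: "computable generators"
  unfolding generators_def[abs_def] by (intro computable_intros)

section \<open>Correctness of the search for a spanning tree\<close>

lemma visited_iff: "visited t p \<longleftrightarrow> p \<in> fst ` set t"
  by (induction t) (auto simp: visited_def)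

lemma lookup_Cons: "lookup (r # t) p = (if fst r = p then snd r else lookup t p)"
  by (simp add: lookup_def)

text \<open>The invariant of the search. Distinct entries that are states bound the length of the
  table; the remaining clauses are the conditions of \<open>spanning_tree\<close> other than closure
  under edges.\<close>

definition good_table :: "(nat, nat) transducer \<Rightarrow> table \<Rightarrow> bool" where
  "good_table T t \<longleftrightarrow>
     distinct (map fst t) \<and> fst ` set t \<subseteq> states T \<and>
     visited t (init T) \<and> lookup t (init T) = ([], []) \<and>
     (\<forall>p. visited t p \<longrightarrow> runs T (init T) (fst (lookup t p)) (snd (lookup t p)) p) \<and>
     (\<forall>p. visited t p \<and> p \<noteq> init T \<longrightarrow>
        (\<exists>p' x u. visited t p' \<and> (p', x, u, p) \<in> edges T \<and>
           fst (lookup t p) = fst (lookup t p') @ [x]))"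

lemma good_table_init: "init T \<in> states T \<Longrightarrow> good_table T [(init T, [], [])]"
  by (auto simp: good_table_def visited_iff lookup_Cons)

text \<open>The new state gets \<open>src e\<close> as its parent. Since it was not visited before,
  no earlier entry is overridden.\<close>

lemma good_table_extend:
  assumes "transducer_over A T" "edge_tuple e \<in> edges T" "good_table T t"
  shows "good_table T (extend e t)"
proof (cases "visited t (src e) \<and> \<not> visited t (tgt e)")
  case True
  let ?v = "(fst (lookup t (src e)) @ [lab e], snd (lookup t (src e)) @ out e)"
  have t': "extend e t = (tgt e, ?v) # t" using True by (simp add: extend_def)
  have edge: "(src e, lab e, out e, tgt e) \<in> edges T" using assms(2) by (simp add: edge_tuple_def)
  then have "delta T (src e) (lab e) = Some (tgt e)" by (simp add: edges_def)
  then have tgt: "tgt e \<in> states T" using assms(1) unfolding transducer_over_def by blast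
  have vis: "visited (extend e t) p \<longleftrightarrow> p = tgt e \<or> visited t p" for p
    by (auto simp: t' visited_iff)
  have look: "lookup (extend e t) p = (if p = tgt e then ?v else lookup t p)" for p
    by (auto simp: t' lookup_Cons)
  have old: "visited t p \<Longrightarrow> lookup (extend e t) p = lookup t p" for p
    using True look by auto
  have good: "distinct (map fst t)" "fst ` set t \<subseteq> states T" "visited t (init T)"
    "lookup t (init T) = ([], [])"
    and run: "\<And>p. visited t p \<Longrightarrow> runs T (init T) (fst (lookup t p)) (snd (lookup t p)) p"
    and par: "\<And>p. visited t p \<Longrightarrow> p \<noteq> init T \<Longrightarrow>
      \<exists>p' x u. visited t p' \<and> (p', x, u, p) \<in> edges T \<and> fst (lookup t p) = fst (lookup t p') @ [x]"
    using assms(3) unfolding good_table_def by blast+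
  have "distinct (map fst (extend e t))" "fst ` set (extend e t) \<subseteq> states T"
    using good(1,2) True tgt by (auto simp: t' visited_iff)
  moreover have "visited (extend e t) (init T)" "lookup (extend e t) (init T) = ([], [])"
    using good(3,4) old vis by auto
  moreover have "runs T (init T) (fst (lookup (extend e t) p)) (snd (lookup (extend e t) p)) p"
    if "visited (extend e t) p" for p
  proof (cases "p = tgt e")
    case True
    then show ?thesis
      using runs_append[OF run, of "src e" "[lab e]" "out e" "tgt e"] edge
        \<open>visited t (src e) \<and> _\<close> by (simp add: look)
  next
    case False
    then show ?thesis using that run by (simp add: vis look)
  qed
  moreover have "\<exists>p' x u. visited (extend e t) p' \<and> (p', x, u, p) \<in> edges T \<and>
      fst (lookup (extend e t) p) = fst (lookup (extend e t) p') @ [x]"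
    if p: "visited (extend e t) p" "p \<noteq> init T" for p
  proof (cases "p = tgt e")
    case True
    then show ?thesis
      using edge \<open>visited t (src e) \<and> _\<close> old[of "src e"]
      by (intro exI[of _ "src e"] exI[of _ "lab e"] exI[of _ "out e"]) (simp add: vis look)
  next
    case False
    then obtain p' x u where "visited t p'" "(p', x, u, p) \<in> edges T"
      "fst (lookup t p) = fst (lookup t p') @ [x]"
      using par[of p] p vis by blast
    then show ?thesis using False old[of p']
      by (intro exI[of _ p'] exI[of _ x] exI[of _ u]) (simp add: vis look)
  qed
  ultimately show ?thesis unfolding good_table_def by blast
qed (use assms(3) in \<open>auto simp: extend_def\<close>)

lemma good_table_sweep:
  assumes "transducer_over A T"
  shows "edge_tuple ` set es \<subseteq> edges T \<Longrightarrow> good_table T t \<Longrightarrow> good_table T (sweep es t)"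
proof (induction es arbitrary: t)
  case (Cons e es)
  then show ?case using good_table_extend[OF assms, of e t] by (simp add: sweep_def)
qed (simp add: sweep_def)

lemma good_table_sweeps:
  assumes "transducer_over A T" "edge_tuple ` set es \<subseteq> edges T"
  shows "good_table T t \<Longrightarrow> good_table T (fold (\<lambda>_. sweep es) qs t)"
  by (induction qs arbitrary: t) (simp_all add: good_table_sweep[OF assms])

definition closed_table :: "edge list \<Rightarrow> table \<Rightarrow> bool" where
  "closed_table es t \<longleftrightarrow> (\<forall>e\<in>set es. extend e t = t)"

lemma length_extend: "extend e t = t \<or> length (extend e t) = Suc (length t)"
  by (simp add: extend_def)

lemma length_sweep: "length t \<le> length (sweep es t)"
proof (induction es arbitrary: t)
  case (Cons e es)
  show ?case using Cons[of "extend e t"] length_extend[of e t] by (auto simp: sweep_def)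
qed (simp add: sweep_def)

lemma sweep_closed: "closed_table es t \<Longrightarrow> sweep es t = t"
  by (induction es) (auto simp: sweep_def closed_table_def)

text \<open>Edges that leave the table unchanged can be skipped; the first one that does not adds an
  entry, and later edges never remove any.\<close>

lemma length_sweep_not_closed: "\<not> closed_table es t \<Longrightarrow> Suc (length t) \<le> length (sweep es t)"
proof (induction es)
  case (Cons e es)
  show ?case
  proof (cases "extend e t = t")
    case True
    then show ?thesis using Cons by (simp add: sweep_def closed_table_def)
  next
    case False
    then show ?thesis
      using length_extend[of e t] length_sweep[of "extend e t" es] by (simp add: sweep_def)
  qed
qed (simp add: closed_table_def)

lemma sweeps_closed: "closed_table es t \<Longrightarrow> fold (\<lambda>_. sweep es) qs t = t"
  by (induction qs) (simp_all add: sweep_closed)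

text \<open>Every sweep that is not the last one adds a state, so as many sweeps as there are states suffice.\<close>

lemma sweeps_closed_or_long:
  "closed_table es (fold (\<lambda>_. sweep es) qs t) \<or>
    length t + length qs \<le> length (fold (\<lambda>_. sweep es) qs t)"
proof (induction qs arbitrary: t)
  case (Cons q qs)
  show ?case
  proof (cases "closed_table es t")
    case True
    then show ?thesis using sweeps_closed[OF True, of "q # qs"] by simp
  next
    case False
    then show ?thesis using Cons[of "sweep es t"] length_sweep_not_closed[OF False] by auto
  qed
qed simp

lemma table_good_closed:
  assumes T: "transducer_over A T"
    and es: "edge_tuple ` set (edge_list i) = edges T"
    and qs: "set (state_list i) = states T" and start: "start i = init T"
  shows "good_table T (table i)" "closed_table (edge_list i) (table i)"
proof -
  have "init T \<in> states T" using T by (simp add: transducer_over_def)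
  then show good: "good_table T (table i)"
    unfolding table_def start
    using good_table_init es by (intro good_table_sweeps[OF T]) simp_all
  show "closed_table (edge_list i) (table i)"
  proof (rule ccontr)
    assume "\<not> ?thesis"
    \<comment> \<open>The initial entry accounts for the extra one. The table would then hold more
      distinct states than there are, since the list of states, possibly with repetitions, contains
      them all.\<close>
    then have "Suc (length (state_list i)) \<le> length (table i)"
      using sweeps_closed_or_long[of "edge_list i" "state_list i" "[(start i, [], [])]"]
      by (simp add: table_def)
    also have "\<dots> = card (fst ` set (table i))"
      using good distinct_card[of "map fst (table i)"] by (simp add: good_table_def)
    also have "\<dots> \<le> card (set (state_list i))"
      using good qs by (intro card_mono List.finite_set) (simp add: good_table_def)
    also have "\<dots> \<le> length (state_list i)" by (rule card_length)
    finally show False by simp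
  qed
qed

text \<open>Closure of the visited states holds because an edge from a visited to an unvisited state
  would still extend the table; the other conditions are part of \<open>good_table\<close>.\<close>

lemma spanning_tree_table:
  assumes T: "transducer_over A T" "inverse_transducer T"
    and es: "edge_tuple ` set es = edges T"
    and t: "good_table T t" "closed_table es t"
  shows "spanning_tree A T (Collect (visited t)) (\<lambda>p. fst (lookup t p)) (\<lambda>p. snd (lookup t p)) edge_code"
proof
  fix p x u q assume p: "p \<in> Collect (visited t)" and "(p, x, u, q) \<in> edges T"
  then obtain e where "e \<in> set es" "edge_tuple e = (p, x, u, q)"
    using es by (metis imageE)
  then have "extend e t = t" "src e = p" "tgt e = q"
    using t(2) by (auto simp: closed_table_def edge_tuple_def)
  then show "q \<in> Collect (visited t)"
    using p by (auto simp: extend_def split: if_splits)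
qed (use T t(1) inj_edge_code in \<open>auto simp: good_table_def\<close>)

theorem theorem4p1:
  "\<exists>algorithm :: recf.
     \<forall>(A :: nat set) (T :: (nat, nat) transducer) (c :: nat).
       finite A \<and> transducer_over A T \<and> inverse_transducer T \<and> encodes_transducer c A T \<longrightarrow>
       (\<exists>(d :: nat) (Y :: nat set) (g :: nat word \<Rightarrow> nat word) (h :: nat word \<Rightarrow> nat word).
          evaluates algorithm [c] d \<and> encodes_hom_pair d Y g h \<and>
          finite Y \<and>
          g \<in> hom (free_group Y) (free_group A) \<and>
          h \<in> hom (free_group Y) (free_group A) \<and>
          inj_on h (carrier (free_group Y)) \<and>
          (equalizer (free_group Y) g h \<noteq> {\<one>\<^bsub>free_group Y\<^esub>} \<longleftrightarrow>
             (\<exists>w. fixed_loop A T w \<and> w \<noteq> \<one>\<^bsub>free_group A\<^esub>)))"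
proof -
  obtain r where r: "\<And>i. evaluates r [enc i] (enc (generators i))"
    using computable_generators unfolding computable_def by blast
  show ?thesis
  proof (intro exI[of _ r] allI impI, elim conjE)
    fix A :: "nat set" and T :: "(nat, nat) transducer" and c
    assume T: "transducer_over A T" "inverse_transducer T" and "encodes_transducer c A T"
    then obtain as qs es0 where qs: "set qs = states T" and es0: "set es0 = edges T"
      and c: "c = list_encode [list_encode as, list_encode qs, init T, list_encode (map edge_code es0)]"
      by (auto simp: encodes_transducer_def)
    define es where "es = map (\<lambda>(p, x, u, q). Edge p x u q) es0"
    have es0_eq: "es0 = map edge_tuple es"
      by (simp add: es_def comp_def case_prod_unfold edge_tuple_def)
    define i where "i = Input as qs (init T) es"
    have "map edge_code es0 = map enc es"
      by (simp add: es0_eq edge_code_edge_tuple)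
    \<comment> \<open>The given number is the code of an element of type \<open>input\<close>, so
      the recursive function for \<open>generators\<close> can be run on it.\<close>
    then have c_enc: "c = enc i"
      by (simp add: c i_def enc_input_def input_fields_def list_encode_eq_enc enc_map_enc)
    let ?t = "table i"
    have es: "edge_tuple ` set es = edges T"
      using es0 by (simp add: es0_eq)
    have t: "good_table T ?t" "closed_table es ?t"
      using table_good_closed[OF T(1), of i] es qs by (simp_all add: i_def)
    interpret spanning_tree A T "Collect (visited ?t)" "\<lambda>p. fst (lookup ?t p)" "\<lambda>p. snd (lookup ?t p)" edge_code
      by (rule spanning_tree_table[OF T es t])
    have loop_eq: "loop (edge_tuple e) = loop_of ?t e" "loop_out (edge_tuple e) = loop_out_of ?t e" for e
      by (simp_all add: loop_def loop_of_def loop_out_def loop_out_of_def edge_tuple_def)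
    have "gens = edge_tuple ` set (filter (is_generator ?t) es)"
    proof -
      have "edge_tuple e \<in> gens \<longleftrightarrow> is_generator ?t e" if "e \<in> set es" for e
        using that es loop_eq(1)[of e] by (auto simp: gens_def is_generator_def edge_tuple_def)
      moreover have "gens \<subseteq> edge_tuple ` set es" unfolding es by (auto simp: gens_def)
      ultimately show ?thesis by fastforce
    qed
    then have Y: "Y = set (map generator_name (generators i))"
      by (simp add: generators_def i_def image_image edge_code_edge_tuple)
    \<comment> \<open>Each entry produced by the algorithm lists the values of the homomorphisms on
      a generator; decoding the name of the generator returns its edge.\<close>
    have gen: "enc y = list_encode [generator_name y, word_code (hom_g [(generator_name y, True)]),
        word_code (hom_h [(generator_name y, True)])]" if y_in: "y \<in> set (generators i)" for y
    proof -
      obtain e where y: "y = Generator (enc e) (free_reduce (loop_out_of ?t e)) (free_reduce (loop_of ?t e))"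
        using y_in by (auto simp: generators_def)
      have "edge_of (enc e) = edge_tuple e"
        using edge_of_name[of "edge_tuple e"] by (simp add: edge_code_edge_tuple)
      then have "hom_g [(enc e, True)] = generator_g y" "hom_h [(enc e, True)] = generator_h y"
        by (simp_all add: y hom_g_def hom_h_def subst_hom_def subst_letter_def loop_eq)
      then show ?thesis
        by (simp add: y enc_generator_def generator_fields_def list_encode_eq_enc word_code_eq_enc)
    qed
    have "encodes_hom_pair (enc (generators i)) Y hom_g hom_h"
      unfolding encodes_hom_pair_def
    proof (intro exI conjI)
      show "set (map generator_name (generators i)) = Y" using Y by simp
      show "enc (generators i) = list_encode (map (\<lambda>y. list_encode [y,
          word_code (hom_g [(y, True)]), word_code (hom_h [(y, True)])]) (map generator_name (generators i)))"
        using gen by (simp add: enc_list_def comp_def cong: map_cong)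
    qed
    moreover have "finite Y" using Y by simp
    moreover have "evaluates r [c] (enc (generators i))" using r c_enc by simp
    ultimately show "\<exists>d Y g h. evaluates r [c] d \<and> encodes_hom_pair d Y g h \<and> finite Y \<and>
        g \<in> hom (free_group Y) (free_group A) \<and> h \<in> hom (free_group Y) (free_group A) \<and>
        inj_on h (carrier (free_group Y)) \<and>
        (equalizer (free_group Y) g h \<noteq> {\<one>\<^bsub>free_group Y\<^esub>} \<longleftrightarrow>
          (\<exists>w. fixed_loop A T w \<and> w \<noteq> \<one>\<^bsub>free_group A\<^esub>))"
      using hom_g_in_hom hom_h_in_hom inj_on_hom_h equalizer_nontrivial_iff by blast
  qed
qed

end
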